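(* Let $n\ge 1$, let $q,\nu\in\mathbb{C}$ be generic, and put $c=-q^{-1}\nu^{-1}$. Let $U_n=(\Lambda_1,\dots,\Lambda_n)$ be an up-down tableau of length $n$ with quantum contents $c_j=c_j(U_n)$, $j=1,\dots,n$, and let $E_{U_n}\in BMW_n(q,\nu)$ be the corresponding primitive idempotent. Define the rational function in $u_1,\dots,u_n$ with values in $BMW_n(q,\nu)$ $$\Psi_{U_n}(u_1,\dots,u_n):=\left(\prod_{k=1}^n\frac{u_k-c_k}{c\,u_k c_k-1}\right)\mathcal{Y}_1(u_1)\,\mathcal{Y}_2(u_1,u_2)\cdots\mathcal{Y}_n(u_1,\dots,u_n),$$ where the functions $\mathcal{Y}_j$ are those defined in the context. Then $E_{U_n}$ is equal to the consecutive evaluation of $\Psi_{U_n}$ at $u_1=c_1$, then $u_2=c_2$, and so on up to $u_n=c_n$ (each evaluation being that of a rational function in the remaining variables): $$E_{U_n}=\Bigl.\bigl.\Psi_{U_n}(u_1,u_2,\dots,u_n)\bigr|_{u_1=c_1}\cdots\Bigr|_{u_n=c_n}.$$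
   Context: **The algebra.** $BMW_n=BMW_n(q,\nu)$ is the unital associative $\mathbb{C}$-algebra generated by invertible elements $T_1,\dots,T_{n-1}$ with defining relations (for all indices for which they make sense) $T_iT_{i+1}T_i=T_{i+1}T_iT_{i+1}$; $T_iT_j=T_jT_i$ for $|i-j|>1$; $\kappa_iT_i=T_i\kappa_i=\nu\kappa_i$; $\kappa_iT_{i-1}^{\varepsilon}\kappa_i=\nu^{-\varepsilon}\kappa_i$ and $\kappa_iT_{i+1}^{\varepsilon}\kappa_i=\nu^{-\varepsilon}\kappa_i$ for $\varepsilon=\pm1$; where $$\kappa_i:=1-\frac{T_i-T_i^{-1}}{q-q^{-1}}.$$ $BMW_{k}\subset BMW_{n}$ for $k\le n$ is the subalgebra generated by $T_1,\dots,T_{k-1}$; $BMW_1=\mathbb{C}$. **Genericity.** $q,\nu$ are nonzero complex parameters assumed generic. In particular: $q-q^{-1}\ne 0$; the algebras $BMW_k$, $k\le n$, are semisimple and the Bratteli diagram of the chain is the up-down Young graph described below; an up-down tableau is uniquely determined by its sequence of quantum contents; and $c\,c_j^{2}\neq 1$ for all quantum contents $c_j$ occurring, where $c=-q^{-1}\nu^{-1}$. **Up-down tableaux and contents.** An up-down tableau of length $n$ and shape $\lambda$ is a sequence $U_n=(\Lambda_1,\dots,\Lambda_n)$ of Young diagrams with $\Lambda_1$ a single box, $\Lambda_j$ obtained from $\Lambda_{j-1}$ by adding or removing exactly one box ($j=2,\dots,n$), and $\Lambda_n=\lambda$. Its $j$-th quantum content $c_j(U_n)$ is $q^{2(b-a)}$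 if the box in row $a$, column $b$ is added to $\Lambda_{j-1}$ to get $\Lambda_j$, and $\nu^2q^{2(a-b)}$ if the box in row $a$, column $b$ is removed from $\Lambda_{j-1}$ to get $\Lambda_j$ ($\Lambda_0$ is empty, so $c_1=1$). **Idempotents.** The Jucys--Murphy elements are $y_1=1$, $y_{k+1}=T_k\cdots T_2T_1^2T_2\cdots T_k$; they pairwise commute. For generic parameters the irreducible representations of $BMW_n$ are labelled by partitions $\lambda$ of $n-2k$, $0\le k\le\lfloor n/2\rfloor$; the representation labelled by $\lambda$ has a basis $\{v_{U_n}\}$ indexed by up-down tableaux $U_n$ of length $n$ and shape $\lambda$ such that $y_j v_{U_n}=c_j(U_n)v_{U_n}$ for $j=1,\dots,n$. $E_{U_n}\in BMW_n$ is the primitive idempotent which acts in the representation labelled by $\lambda$ as the projector onto $\mathbb{C}v_{U_n}$ along the span of the other basis vectors, and which annihilates all other irreducible representations. **Baxterized elements.** For spectral variables $u,v$, $$T_i(u,v):=T_i+\frac{q-q^{-1}}{v/u-1}+\frac{q-q^{-1}}{1+\nu^{-1}q\,v/u}\,\kappa_i,\qquad Q_i(u,v;c):=T_i+\frac{q-q^{-1}}{cuv-1}+\frac{q-q^{-1}}{1+\nu^{-1}q\,cuv}\,\kappa_i .$$ $T_i(u,v)$ is invertible as a rational function, with $T_i(v,u)^{-1}=T_i(u,v)\dfrac{(u-v)^2}{(u-q^2v)(u-q^{-2}v)}$. **The functions $\mathcal{Y}_j$.** $\mathcal{Y}_1(u):=\dfrac{cu\,y_1-1}{u-y_1}=\dfrac{cu-1}{u-1}$,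 and for $j\ge2$ $$\mathcal{Y}_j(u_1,\dots,u_j):=Q_{j-1}(u_{j-1},u_j;c)\,\mathcal{Y}_{j-1}(u_1,\dots,u_{j-2},u_j)\,T_{j-1}(u_j,u_{j-1})^{-1}.$$ *)

theory Defs
  imports Complex_Main "HOL-Library.Poly_Mapping"
begin

section \<open>Unital associative complex algebras\<close>

class complex_algebra_1 = ring_1 +
  fixes scaleC :: "complex \<Rightarrow> 'a \<Rightarrow> 'a"  (infixr "*\<^sub>C" 75)
  assumes scaleC_add_right: "a *\<^sub>C (x + y) = a *\<^sub>C x + a *\<^sub>C y"
    and scaleC_add_left: "(a + b) *\<^sub>C x = a *\<^sub>C x + b *\<^sub>C x"
    and scaleC_scaleC: "a *\<^sub>C b *\<^sub>C x = (a * b) *\<^sub>C x"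
    and scaleC_one: "1 *\<^sub>C x = x"
    and mult_scaleC_left: "(a *\<^sub>C x) * y = a *\<^sub>C (x * y)"
    and mult_scaleC_right: "x * (a *\<^sub>C y) = a *\<^sub>C (x * y)"

global_interpretation complex_vector:
  vector_space "scaleC :: complex \<Rightarrow> 'a::complex_algebra_1 \<Rightarrow> 'a"
  by unfold_locales
    (simp_all add: scaleC_add_right scaleC_add_left scaleC_scaleC scaleC_one)

instantiation complex :: complex_algebra_1
begin

definition scaleC_complex :: "complex \<Rightarrow> complex \<Rightarrow> complex"
  where "scaleC_complex a x = a * x"

instance
  by standard (simp_all add: scaleC_complex_def algebra_simps)

end

text \<open>Two-sided inverse; meaningful only when the element is invertible.\<close>

definition ring_inv :: "'a::ring_1 \<Rightarrow> 'a"
  where "ring_inv x = (THE y. x * y = 1 \<and> y * x = 1)"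

definition subalgebra :: "'a::complex_algebra_1 set \<Rightarrow> bool"
  where "subalgebra B \<longleftrightarrow> complex_vector.subspace B \<and> 1 \<in> B \<and> (\<forall>x\<in>B. \<forall>y\<in>B. x * y \<in> B)"


section \<open>Presentations by generators and relations\<close>

text \<open>The free algebra on a set of generators is the monoid algebra of the free monoid; the
  monoid of words is written additively because \<open>poly_mapping\<close> convolves along addition.\<close>

datatype 'g word = Word (letters: "'g list")

instantiation word :: (type) monoid_add
begin

definition zero_word :: "'a word"
  where "0 = Word []"

definition plus_word :: "'a word \<Rightarrow> 'a word \<Rightarrow> 'a word"
  where "v + w = Word (letters v @ letters w)"

instance
  by standard (simp_all add: zero_word_def plus_word_def)

end

type_synonym 'g free_algebra = "'g word \<Rightarrow>\<^sub>0 complex"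

definition free_gen :: "'g \<Rightarrow> 'g free_algebra"
  where "free_gen g = Poly_Mapping.single (Word [g]) 1"

definition free_const :: "complex \<Rightarrow> 'g free_algebra"
  where "free_const a = Poly_Mapping.single 0 a"

definition free_on :: "'g set \<Rightarrow> 'g free_algebra set"
  where "free_on X = {p. \<forall>w\<in>Poly_Mapping.keys p. set (letters w) \<subseteq> X}"

definition free_eval :: "('g \<Rightarrow> 'a::complex_algebra_1) \<Rightarrow> 'g free_algebra \<Rightarrow> 'a"
  where "free_eval f p =
    (\<Sum>w\<in>Poly_Mapping.keys p. Poly_Mapping.lookup p w *\<^sub>C prod_list (map f (letters w)))"

definition two_sided_ideal :: "'r::ring_1 set \<Rightarrow> 'r set \<Rightarrow> bool"
  where "two_sided_ideal S I \<longleftrightarrow> I \<subseteq> S \<and> 0 \<in> I \<and> (\<forall>x\<in>I. \<forall>y\<in>I. x + y \<in> I) \<and>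
    (\<forall>s\<in>S. \<forall>x\<in>I. s * x \<in> I \<and> x * s \<in> I)"

text \<open>The type \<open>'a\<close>, with the generators \<open>X\<close> interpreted by \<open>f\<close>, is (isomorphic to) the quotient
  of the free algebra on \<open>X\<close> by the two-sided ideal generated by the relators \<open>R\<close>.\<close>

definition presented_by ::
    "'g set \<Rightarrow> 'g free_algebra set \<Rightarrow> ('g \<Rightarrow> 'a::complex_algebra_1) \<Rightarrow> bool"
  where "presented_by X R f \<longleftrightarrow>
    free_eval f ` free_on X = UNIV \<and>
    (\<forall>p\<in>free_on X. free_eval f p = 0 \<longleftrightarrow> p \<in> two_sided_ideal (free_on X) hull R)"


section \<open>The Birman--Murakami--Wenzl algebra\<close>

datatype bmw_gen = Gen nat | GenInv nat

definition bmw_gens :: "nat \<Rightarrow> bmw_gen set"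
  where "bmw_gens n = Gen ` {1..<n} \<union> GenInv ` {1..<n}"

definition free_kappa :: "complex \<Rightarrow> nat \<Rightarrow> bmw_gen free_algebra"
  where "free_kappa q i =
    1 - free_const (1 / (q - inverse q)) * (free_gen (Gen i) - free_gen (GenInv i))"

definition bmw_relators :: "nat \<Rightarrow> complex \<Rightarrow> complex \<Rightarrow> bmw_gen free_algebra set"
  where "bmw_relators n q \<nu> =
    (let t = (\<lambda>i. free_gen (Gen i)); t' = (\<lambda>i. free_gen (GenInv i));
         \<kappa> = free_kappa q; a = free_const \<nu>; a' = free_const (inverse \<nu>) in
      {t i * t' i - 1 | i. 1 \<le> i \<and> i < n} \<union>
      {t' i * t i - 1 | i. 1 \<le> i \<and> i < n} \<union>
      {t i * t (i + 1) * t i - t (i + 1) * t i * t (i + 1) | i. 1 \<le> i \<and> i + 1 < n} \<union>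
      {t i * t j - t j * t i | i j. 1 \<le> i \<and> i < n \<and> 1 \<le> j \<and> j < n \<and> \<bar>int i - int j\<bar> > 1} \<union>
      {\<kappa> i * t i - a * \<kappa> i | i. 1 \<le> i \<and> i < n} \<union>
      {t i * \<kappa> i - a * \<kappa> i | i. 1 \<le> i \<and> i < n} \<union>
      {\<kappa> i * t (i - 1) * \<kappa> i - a' * \<kappa> i | i. 2 \<le> i \<and> i < n} \<union>
      {\<kappa> i * t' (i - 1) * \<kappa> i - a * \<kappa> i | i. 2 \<le> i \<and> i < n} \<union>
      {\<kappa> i * t (i + 1) * \<kappa> i - a' * \<kappa> i | i. 1 \<le> i \<and> i + 1 < n} \<union>
      {\<kappa> i * t' (i + 1) * \<kappa> i - a * \<kappa> i | i. 1 \<le> i \<and> i + 1 < n})"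

text \<open>The type \<open>'a\<close> is the algebra $BMW_n(q,\nu)$ with generators \<open>T 1, \<dots>, T (n - 1)\<close>; the
  values of \<open>T\<close> outside this range are irrelevant.\<close>

definition is_bmw :: "nat \<Rightarrow> complex \<Rightarrow> complex \<Rightarrow> (nat \<Rightarrow> 'a::complex_algebra_1) \<Rightarrow> bool"
  where "is_bmw n q \<nu> T \<longleftrightarrow>
    presented_by (bmw_gens n) (bmw_relators n q \<nu>)
      (\<lambda>g. case g of Gen i \<Rightarrow> T i | GenInv i \<Rightarrow> ring_inv (T i))"

definition bmw_sub :: "(nat \<Rightarrow> 'a::complex_algebra_1) \<Rightarrow> nat \<Rightarrow> 'a set"
  where "bmw_sub T k = subalgebra hull (T ` {1..<k})"

definition kappa :: "complex \<Rightarrow> (nat \<Rightarrow> 'a::complex_algebra_1) \<Rightarrow> nat \<Rightarrow> 'a"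
  where "kappa q T i = 1 - (1 / (q - inverse q)) *\<^sub>C (T i - ring_inv (T i))"

text \<open>\<open>jucys_murphy T j\<close> is $T_{j-1}\cdots T_2T_1\cdot T_1T_2\cdots T_{j-1}$, and $1$ for $j=1$.\<close>

definition jucys_murphy :: "(nat \<Rightarrow> 'a::complex_algebra_1) \<Rightarrow> nat \<Rightarrow> 'a"
  where "jucys_murphy T j = prod_list (map T (rev [1..<j])) * prod_list (map T [1..<j])"


section \<open>Up-down tableaux and quantum contents\<close>

type_synonym diagram = "(nat \<times> nat) set"

text \<open>Young diagrams as sets of boxes \<open>(row, column)\<close>, both coordinates starting from 1.\<close>

definition young_diagram :: "diagram \<Rightarrow> bool"
  where "young_diagram \<Lambda> \<longleftrightarrow> finite \<Lambda> \<and>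
    (\<forall>(a, b)\<in>\<Lambda>. 1 \<le> a \<and> 1 \<le> b \<and> {1..a} \<times> {1..b} \<subseteq> \<Lambda>)"

definition differ_by_box :: "diagram \<Rightarrow> diagram \<Rightarrow> bool"
  where "differ_by_box \<Lambda> M \<longleftrightarrow>
    (\<exists>x. x \<notin> \<Lambda> \<and> M = insert x \<Lambda>) \<or> (\<exists>x. x \<in> \<Lambda> \<and> M = \<Lambda> - {x})"

definition updown_tableau :: "diagram list \<Rightarrow> bool"
  where "updown_tableau U \<longleftrightarrow> U \<noteq> [] \<and> (\<forall>\<Lambda>\<in>set U. young_diagram \<Lambda>) \<and> hd U = {(1, 1)} \<and>
    (\<forall>i. Suc i < length U \<longrightarrow> differ_by_box (U ! i) (U ! Suc i))"

definition tableaux :: "nat \<Rightarrow> diagram \<Rightarrow> diagram list set"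
  where "tableaux k \<Lambda> = {U. updown_tableau U \<and> length U = k \<and> last U = \<Lambda>}"

definition shapes :: "nat \<Rightarrow> diagram set"
  where "shapes k = {\<Lambda>. young_diagram \<Lambda> \<and> (\<exists>m. card \<Lambda> + 2 * m = k)}"

text \<open>Contents are indexed by \<open>j = 1, \<dots>, length U\<close>; the list \<open>{} # U\<close> supplies the empty diagram
  preceding the first one.\<close>

definition content :: "complex \<Rightarrow> complex \<Rightarrow> diagram list \<Rightarrow> nat \<Rightarrow> complex"
  where "content q \<nu> U j =
    (let \<Lambda> = ({} # U) ! (j - 1); M = ({} # U) ! j in
      if \<Lambda> \<subseteq> M then (case THE x. x \<in> M - \<Lambda> of (a, b) \<Rightarrow> q powi (2 * (int b - int a)))
      else (case THE x. x \<in> \<Lambda> - M of (a, b) \<Rightarrow> \<nu>\<^sup>2 * q powi (2 * (int a - int b))))"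

definition c_param :: "complex \<Rightarrow> complex \<Rightarrow> complex"
  where "c_param q \<nu> = - inverse q * inverse \<nu>"


section \<open>Semisimplicity and representations\<close>

definition left_ideal :: "'a::ring_1 set \<Rightarrow> 'a set \<Rightarrow> bool"
  where "left_ideal B L \<longleftrightarrow> L \<subseteq> B \<and> 0 \<in> L \<and> (\<forall>x\<in>L. \<forall>y\<in>L. x + y \<in> L) \<and>
    (\<forall>b\<in>B. \<forall>x\<in>L. b * x \<in> L)"

text \<open>Finite-dimensional semisimple algebra: every left ideal has a complementary left ideal.\<close>

definition semisimple :: "'a::complex_algebra_1 set \<Rightarrow> bool"
  where "semisimple B \<longleftrightarrow> (\<exists>S. finite S \<and> B = complex_vector.span S) \<and>
    (\<forall>L. left_ideal B L \<longrightarrow>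
      (\<exists>L'. left_ideal B L' \<and> L \<inter> L' = {0} \<and> B = {x + y | x y. x \<in> L \<and> y \<in> L'}))"

text \<open>A representation of the subalgebra \<open>B\<close> on a space with basis indexed by the finite set \<open>I\<close>:
  \<open>\<rho> x i j\<close> is the coefficient of the \<open>i\<close>-th basis vector in the image under \<open>x\<close> of the \<open>j\<close>-th one.
  Vectors are functions vanishing outside \<open>I\<close>.\<close>

definition matrix_rep ::
    "'a::complex_algebra_1 set \<Rightarrow> 'i set \<Rightarrow> ('a \<Rightarrow> 'i \<Rightarrow> 'i \<Rightarrow> complex) \<Rightarrow> bool"
  where "matrix_rep B I \<rho> \<longleftrightarrow> finite I \<and>
    (\<forall>i\<in>I. \<forall>j\<in>I. \<rho> 1 i j = of_bool (i = j)) \<and>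
    (\<forall>a. \<forall>x\<in>B. \<forall>i\<in>I. \<forall>j\<in>I. \<rho> (a *\<^sub>C x) i j = a * \<rho> x i j) \<and>
    (\<forall>x\<in>B. \<forall>y\<in>B. \<forall>i\<in>I. \<forall>j\<in>I. \<rho> (x + y) i j = \<rho> x i j + \<rho> y i j) \<and>
    (\<forall>x\<in>B. \<forall>y\<in>B. \<forall>i\<in>I. \<forall>j\<in>I. \<rho> (x * y) i j = (\<Sum>k\<in>I. \<rho> x i k * \<rho> y k j))"

definition vectors :: "'i set \<Rightarrow> ('i \<Rightarrow> complex) set"
  where "vectors I = {f. \<forall>i. i \<notin> I \<longrightarrow> f i = 0}"

definition mat_apply :: "'i set \<Rightarrow> ('i \<Rightarrow> 'i \<Rightarrow> complex) \<Rightarrow> ('i \<Rightarrow> complex) \<Rightarrow> 'i \<Rightarrow> complex"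
  where "mat_apply I M f = (\<lambda>i. if i \<in> I then \<Sum>j\<in>I. M i j * f j else 0)"

definition invariant_subspace ::
    "'a::complex_algebra_1 set \<Rightarrow> 'i set \<Rightarrow> ('a \<Rightarrow> 'i \<Rightarrow> 'i \<Rightarrow> complex) \<Rightarrow> ('i \<Rightarrow> complex) set \<Rightarrow> bool"
  where "invariant_subspace B I \<rho> W \<longleftrightarrow> W \<subseteq> vectors I \<and> (\<lambda>_. 0) \<in> W \<and>
    (\<forall>f\<in>W. \<forall>g\<in>W. (\<lambda>i. f i + g i) \<in> W) \<and> (\<forall>a. \<forall>f\<in>W. (\<lambda>i. a * f i) \<in> W) \<and>
    (\<forall>x\<in>B. \<forall>f\<in>W. mat_apply I (\<rho> x) f \<in> W)"

definition irreducible_rep ::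
    "'a::complex_algebra_1 set \<Rightarrow> 'i set \<Rightarrow> ('a \<Rightarrow> 'i \<Rightarrow> 'i \<Rightarrow> complex) \<Rightarrow> bool"
  where "irreducible_rep B I \<rho> \<longleftrightarrow> matrix_rep B I \<rho> \<and> I \<noteq> {} \<and>
    (\<forall>W. invariant_subspace B I \<rho> W \<longrightarrow> W = {\<lambda>_. 0} \<or> W = vectors I)"

definition equivalent_reps ::
    "'a::complex_algebra_1 set \<Rightarrow> 'i set \<Rightarrow> ('a \<Rightarrow> 'i \<Rightarrow> 'i \<Rightarrow> complex) \<Rightarrow>
      'j set \<Rightarrow> ('a \<Rightarrow> 'j \<Rightarrow> 'j \<Rightarrow> complex) \<Rightarrow> bool"
  where "equivalent_reps B I \<rho> J \<sigma> \<longleftrightarrow> (\<exists>P Q.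
    (\<forall>i\<in>I. \<forall>k\<in>I. (\<Sum>j\<in>J. Q i j * P j k) = of_bool (i = k)) \<and>
    (\<forall>j\<in>J. \<forall>k\<in>J. (\<Sum>i\<in>I. P j i * Q i k) = of_bool (j = k)) \<and>
    (\<forall>x\<in>B. \<forall>j\<in>J. \<forall>i\<in>I. (\<Sum>k\<in>I. P j k * \<rho> x k i) = (\<Sum>k\<in>J. \<sigma> x j k * P k i)))"

text \<open>\<open>\<rho> k \<Lambda>\<close> is the irreducible representation of $BMW_k$ labelled by \<open>\<Lambda>\<close>, written in the basis
  $\{v_U\}$ indexed by the up-down tableaux of length \<open>k\<close> and shape \<open>\<Lambda>\<close>.\<close>

definition labelled_irreps ::
    "nat \<Rightarrow> complex \<Rightarrow> complex \<Rightarrow> (nat \<Rightarrow> 'a::complex_algebra_1) \<Rightarrow>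
      (nat \<Rightarrow> diagram \<Rightarrow> 'a \<Rightarrow> diagram list \<Rightarrow> diagram list \<Rightarrow> complex) \<Rightarrow> bool"
  where "labelled_irreps n q \<nu> T \<rho> \<longleftrightarrow> (\<forall>k\<in>{1..n}.
    (\<forall>\<Lambda>\<in>shapes k. irreducible_rep (bmw_sub T k) (tableaux k \<Lambda>) (\<rho> k \<Lambda>)) \<and>
    (\<forall>\<Lambda>\<in>shapes k. \<forall>M\<in>shapes k.
      equivalent_reps (bmw_sub T k) (tableaux k \<Lambda>) (\<rho> k \<Lambda>) (tableaux k M) (\<rho> k M) \<longrightarrow> \<Lambda> = M) \<and>
    (\<forall>(I :: nat set) \<sigma>. irreducible_rep (bmw_sub T k) I \<sigma> \<longrightarrow>
      (\<exists>\<Lambda>\<in>shapes k. equivalent_reps (bmw_sub T k) I \<sigma> (tableaux k \<Lambda>) (\<rho> k \<Lambda>))) \<and>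
    (\<forall>\<Lambda>\<in>shapes k. \<forall>U\<in>tableaux k \<Lambda>. \<forall>V\<in>tableaux k \<Lambda>. \<forall>j\<in>{1..k}.
      \<rho> k \<Lambda> (jucys_murphy T j) V U = content q \<nu> U j * of_bool (V = U)))"

text \<open>The Bratteli diagram is the up-down Young graph: the restriction of the representation \<open>\<Lambda>\<close> of
  $BMW_k$ to $BMW_{k-1}$ is the direct sum of the representations labelled by the diagrams that differ
  from \<open>\<Lambda>\<close> by one box. Removing the last diagram of a tableau identifies \<open>tableaux k \<Lambda>\<close>
  with the disjoint union of the corresponding \<open>tableaux (k - 1) M\<close>.\<close>

definition updown_branching ::
    "nat \<Rightarrow> (nat \<Rightarrow> 'a::complex_algebra_1) \<Rightarrow>
      (nat \<Rightarrow> diagram \<Rightarrow> 'a \<Rightarrow> diagram list \<Rightarrow> diagram list \<Rightarrow> complex) \<Rightarrow> bool"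
  where "updown_branching n T \<rho> \<longleftrightarrow> (\<forall>k\<in>{2..n}. \<forall>\<Lambda>\<in>shapes k.
    equivalent_reps (bmw_sub T (k - 1)) (tableaux k \<Lambda>) (\<rho> k \<Lambda>) (tableaux k \<Lambda>)
      (\<lambda>x V U. if last (butlast V) = last (butlast U)
        then \<rho> (k - 1) (last (butlast U)) x (butlast V) (butlast U) else 0))"

text \<open>Genericity of the parameters, apart from the Bratteli diagram. Semisimplicity refers to the
  algebra generated by \<open>T\<close>.\<close>

definition generic_params ::
    "nat \<Rightarrow> complex \<Rightarrow> complex \<Rightarrow> (nat \<Rightarrow> 'a::complex_algebra_1) \<Rightarrow> bool"
  where "generic_params n q \<nu> T \<longleftrightarrow> q \<noteq> 0 \<and> \<nu> \<noteq> 0 \<and> q - inverse q \<noteq> 0 \<and>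
    (\<forall>k\<in>{1..n}. semisimple (bmw_sub T k)) \<and>
    (\<forall>U V. updown_tableau U \<and> updown_tableau V \<and> length U = length V \<and> length U \<le> n \<and>
      (\<forall>j\<in>{1..length U}. content q \<nu> U j = content q \<nu> V j) \<longrightarrow> U = V) \<and>
    (\<forall>U. updown_tableau U \<and> length U \<le> n \<longrightarrow>
      (\<forall>j\<in>{1..length U}. c_param q \<nu> * (content q \<nu> U j)\<^sup>2 \<noteq> 1))"

definition is_tableau_idempotent ::
    "nat \<Rightarrow> (nat \<Rightarrow> diagram \<Rightarrow> 'a::complex_algebra_1 \<Rightarrow> diagram list \<Rightarrow> diagram list \<Rightarrow> complex) \<Rightarrow>
      diagram list \<Rightarrow> 'a \<Rightarrow> bool"
  where "is_tableau_idempotent n \<rho> U E \<longleftrightarrow>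
    (\<forall>V\<in>tableaux n (last U). \<forall>W\<in>tableaux n (last U).
      \<rho> n (last U) E V W = of_bool (V = U \<and> W = U)) \<and>
    (\<forall>M\<in>shapes n - {last U}. \<forall>V\<in>tableaux n M. \<forall>W\<in>tableaux n M. \<rho> n M E V W = 0)"


section \<open>Rational functions and consecutive evaluation\<close>

text \<open>Polynomial functions of $u_1,\dots,u_n$ with values in an algebra; the point \<open>u\<close> is a
  sequence of which only the entries \<open>1, \<dots>, n\<close> matter.\<close>

inductive poly_fun :: "nat \<Rightarrow> ((nat \<Rightarrow> complex) \<Rightarrow> 'a::complex_algebra_1) \<Rightarrow> bool" for n where
  const: "poly_fun n (\<lambda>_. a)"
| add: "poly_fun n f \<Longrightarrow> poly_fun n g \<Longrightarrow> poly_fun n (\<lambda>u. f u + g u)"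
| var: "poly_fun n f \<Longrightarrow> k \<in> {1..n} \<Longrightarrow> poly_fun n (\<lambda>u. u k *\<^sub>C f u)"

text \<open>A rational function is represented by any total function that agrees with it off the zero set
  of some nonzero polynomial, and two such functions represent the same rational function iff they
  agree off the zero set of a nonzero polynomial. In particular the values at poles, where division
  by zero yields zero, are irrelevant.\<close>

definition rat_eq ::
    "nat \<Rightarrow> ((nat \<Rightarrow> complex) \<Rightarrow> 'a) \<Rightarrow> ((nat \<Rightarrow> complex) \<Rightarrow> 'a) \<Rightarrow> bool"
  where "rat_eq n f g \<longleftrightarrow> (\<exists>e :: (nat \<Rightarrow> complex) \<Rightarrow> complex.
    poly_fun n e \<and> (\<exists>u. e u \<noteq> 0) \<and> (\<forall>u. e u \<noteq> 0 \<longrightarrow> f u = g u))"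

text \<open>\<open>f\<close> is a rational function, regular along the hyperplane $u_k=a$, and its restriction to the
  hyperplane is the rational function \<open>g\<close> of the remaining variables.\<close>

definition evaluates_to ::
    "nat \<Rightarrow> nat \<Rightarrow> complex \<Rightarrow> ((nat \<Rightarrow> complex) \<Rightarrow> 'a::complex_algebra_1) \<Rightarrow>
      ((nat \<Rightarrow> complex) \<Rightarrow> 'a) \<Rightarrow> bool"
  where "evaluates_to n k a f g \<longleftrightarrow> (\<exists>P (d :: (nat \<Rightarrow> complex) \<Rightarrow> complex).
    poly_fun n P \<and> poly_fun n d \<and> (\<exists>u. d (u(k := a)) \<noteq> 0) \<and>
    rat_eq n f (\<lambda>u. inverse (d u) *\<^sub>C P u) \<and>
    rat_eq n g (\<lambda>u. inverse (d (u(k := a))) *\<^sub>C P (u(k := a))))"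

text \<open>Evaluating \<open>f\<close> at $u_1=a_1$, then at $u_2=a_2$, and so on up to $u_n=a_n$ is possible and
  yields the element \<open>x\<close>.\<close>

definition consecutive_evaluation ::
    "nat \<Rightarrow> (nat \<Rightarrow> complex) \<Rightarrow> ((nat \<Rightarrow> complex) \<Rightarrow> 'a::complex_algebra_1) \<Rightarrow> 'a \<Rightarrow> bool"
  where "consecutive_evaluation n a f x \<longleftrightarrow> (\<exists>F. F 0 = f \<and>
    (\<forall>k\<in>{1..n}. evaluates_to n k (a k) (F (k - 1)) (F k)) \<and> rat_eq n (F n) (\<lambda>_. x))"


section \<open>Baxterized elements and the function \<open>\<Psi>\<close>\<close>

definition baxter_T ::
    "complex \<Rightarrow> complex \<Rightarrow> (nat \<Rightarrow> 'a::complex_algebra_1) \<Rightarrow> nat \<Rightarrow> complex \<Rightarrow> complex \<Rightarrow> 'a"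
  where "baxter_T q \<nu> T i u v = T i + ((q - inverse q) / (v / u - 1)) *\<^sub>C 1
    + ((q - inverse q) / (1 + inverse \<nu> * q * (v / u))) *\<^sub>C kappa q T i"

definition baxter_Q ::
    "complex \<Rightarrow> complex \<Rightarrow> (nat \<Rightarrow> 'a::complex_algebra_1) \<Rightarrow> nat \<Rightarrow> complex \<Rightarrow> complex \<Rightarrow> complex \<Rightarrow> 'a"
  where "baxter_Q q \<nu> T i u v c = T i + ((q - inverse q) / (c * u * v - 1)) *\<^sub>C 1
    + ((q - inverse q) / (1 + inverse \<nu> * q * c * u * v)) *\<^sub>C kappa q T i"

text \<open>\<open>baxter_Y q \<nu> T j u w\<close> is $\mathcal{Y}_j(u_1,\dots,u_{j-1},w)$. The inverse is taken pointwise,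
  which represents the inverse as a rational function. The value at \<open>j = 0\<close> is not used.\<close>

fun baxter_Y ::
    "complex \<Rightarrow> complex \<Rightarrow> (nat \<Rightarrow> 'a::complex_algebra_1) \<Rightarrow> nat \<Rightarrow> (nat \<Rightarrow> complex) \<Rightarrow> complex \<Rightarrow> 'a"
  where
    "baxter_Y q \<nu> T 0 u w = 1"
  | "baxter_Y q \<nu> T (Suc 0) u w = ((c_param q \<nu> * w - 1) / (w - 1)) *\<^sub>C 1"
  | "baxter_Y q \<nu> T (Suc (Suc j)) u w =
      baxter_Q q \<nu> T (Suc j) (u (Suc j)) w (c_param q \<nu>) * baxter_Y q \<nu> T (Suc j) u w
        * ring_inv (baxter_T q \<nu> T (Suc j) w (u (Suc j)))"

definition Psi ::
    "nat \<Rightarrow> complex \<Rightarrow> complex \<Rightarrow> (nat \<Rightarrow> 'a::complex_algebra_1) \<Rightarrow> diagram list \<Rightarrow>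
      (nat \<Rightarrow> complex) \<Rightarrow> 'a"
  where "Psi n q \<nu> T U u =
    (\<Prod>k=1..n. (u k - content q \<nu> U k) / (c_param q \<nu> * u k * content q \<nu> U k - 1)) *\<^sub>C
      prod_list (map (\<lambda>j. baxter_Y q \<nu> T j u (u j)) [1..<Suc n])"

end

theory Submission
  imports "HOL-Computational_Algebra.Polynomial" Defs
begin

text \<open>Let $e_k$ be the product of the spectral projections of $y_1,\dots,y_k$ for the eigenvalues
  $c_1,\dots,c_k$. With $x=y_k$ and $y=y_{k+1}=T_kxT_k$, the relation $xy\kappa_k=\nu^2\kappa_k$ yields the
  projected reflection equation
  $$e_k(w-y)\,Q_k(c_k,w;c)\,(cwx-1)=e_k(cwy-1)\,T_k(w,c_k)\,(w-x),$$
  and induction on $k$ turns it into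
  $e_{k-1}\mathcal{Y}_k(c_1,\dots,c_{k-1},w)=e_{k-1}(cwy_k-1)(w-y_k)^{-1}$. By the spectral
  decomposition of $y_k$, this function times $(w-c_k)/(cwc_k-1)$ is regular at $w=c_k$ with value
  $e_k$, so after $k$ evaluations the prefix of $\Psi$ has become $e_k$. Finally $e_n=E_{U_n}$ because
  the irreducible representations of a semisimple algebra are jointly faithful.\<close>

section \<open>Evaluation of rational functions\<close>

text \<open>The projection is what makes a closed formula possible: behind e_k the element x acts as
  the scalar c_k, while the shorter idempotent e_{k-1} commutes with T_k and can be carried inward
  to the previous function. The constant c = -1/(q \<nu>) is the one for which the \<kappa>-terms
  cancel. Since x y \<kappa> = \<nu>^2 \<kappa>, the element y acts on e_k \<kappa> as \<nu>^2/c_k,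
  so e_k (w - y) \<kappa> and e_k (c w y - 1) \<kappa> are scalar multiples of e_k \<kappa>,
  vanishing at w = \<nu>^2/c_k and w = -q c_k/\<nu>. These are exactly the poles of the
  \<kappa>-coefficients of Q_k(c_k,w;c) and T_k(w,c_k). The other difficulty is regularity. At u_k =
  c_k only the factor with index k can become singular, and its simple pole is matched by a zero of
  the scalar prefactor. Every later factor stays regular because each of its denominators still
  contains a free variable u_j with j > k.\<close>

lemma poly_fun_scaleC: "poly_fun n f \<Longrightarrow> poly_fun n (\<lambda>u. a *\<^sub>C f u)"
proof (induction rule: poly_fun.induct)
  case (const b)
  show ?case by (rule poly_fun.const)
next
  case (add f g)
  then show ?case by (simp add: scaleC_add_right poly_fun.add)
next
  case (var f k)
  then have "poly_fun n (\<lambda>u. u k *\<^sub>C (a *\<^sub>C f u))" by (intro poly_fun.var)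
  then show ?case by (simp add: scaleC_scaleC mult.commute)
qed

lemma poly_fun_mult:
  assumes "poly_fun n f" "poly_fun n g"
  shows "poly_fun n (\<lambda>u. f u * g u)"
  using assms(1)
proof (induction rule: poly_fun.induct)
  case (const b)
  show ?case
    using assms(2)
  proof (induction rule: poly_fun.induct)
    case (var f k)
    then show ?case by (simp add: mult_scaleC_right poly_fun.var)
  qed (simp_all add: distrib_left poly_fun.const poly_fun.add)
next
  case (var f k)
  then show ?case by (simp add: mult_scaleC_left poly_fun.var)
qed (simp_all add: distrib_right poly_fun.add)

lemma poly_fun_coord: "k \<in> {1..n} \<Longrightarrow> poly_fun n (\<lambda>u. u k)"
  using poly_fun.var[OF poly_fun.const[of n "1::complex"]] by (simp add: scaleC_complex_def)

lemma poly_fun_uminus: "poly_fun n f \<Longrightarrow> poly_fun n (\<lambda>u. - f u)"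
  using poly_fun_scaleC[of n f "-1"] by (simp add: scaleC_one)

lemma poly_fun_diff: "poly_fun n f \<Longrightarrow> poly_fun n g \<Longrightarrow> poly_fun n (\<lambda>u. f u - g u)"
  using poly_fun.add[of n f "\<lambda>u. - g u"] by (simp add: poly_fun_uminus)

lemma poly_fun_scaleC_fun:
  fixes f :: "(nat \<Rightarrow> complex) \<Rightarrow> complex"
  assumes "poly_fun n f" "poly_fun n g"
  shows "poly_fun n (\<lambda>u. f u *\<^sub>C g u)"
proof -
  \<comment> \<open>Embedding the scalar polynomial as a multiple of 1 puts both factors into the
    same algebra, where closure under products applies.\<close>
  have "poly_fun n (\<lambda>u. f u *\<^sub>C (1 :: 'a))"
    using assms(1)
  proof (induction rule: poly_fun.induct)
    case (var f k)
    then show ?case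
      using poly_fun.var[of n "\<lambda>u. f u *\<^sub>C (1 :: 'a)" k]
      by (simp add: scaleC_complex_def scaleC_scaleC)
  qed (simp_all add: scaleC_add_left poly_fun.const poly_fun.add)
  from poly_fun_mult[OF this assms(2)] show ?thesis
    by (simp add: mult_scaleC_left)
qed

lemma poly_fun_upd: "poly_fun n f \<Longrightarrow> poly_fun n (\<lambda>u. f (u(k := a)))"
proof (induction rule: poly_fun.induct)
  case (var f j)
  then show ?case
    by (cases "j = k") (simp_all add: poly_fun.var poly_fun_scaleC)
qed (simp_all add: poly_fun.const poly_fun.add)

lemmas poly_fun_intros =
  poly_fun.const poly_fun.add poly_fun_diff poly_fun_mult poly_fun_coord poly_fun_uminus

section \<open>Nonvanishing of polynomials and generic validity\<close>

lemma poly_fun_on_line: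
  fixes f :: "(nat \<Rightarrow> complex) \<Rightarrow> complex"
  assumes "poly_fun n f"
  shows "\<exists>p. \<forall>t. f (\<lambda>i. u i + t * (v i - u i)) = poly p t"
  using assms
proof (induction rule: poly_fun.induct)
  case (const a)
  show ?case by (rule exI[of _ "[:a:]"]) simp
next
  case (add f g)
  then obtain p r where "\<forall>t. f (\<lambda>i. u i + t * (v i - u i)) = poly p t"
    "\<forall>t. g (\<lambda>i. u i + t * (v i - u i)) = poly r t" by blast
  then show ?case by (intro exI[of _ "p + r"]) simp
next
  case (var f k)
  then obtain p where "\<forall>t. f (\<lambda>i. u i + t * (v i - u i)) = poly p t" by blast
  then show ?case
    by (intro exI[of _ "[:u k, v k - u k:] * p"]) (simp add: scaleC_complex_def algebra_simps)
qed

text \<open>Polynomials in several variables have no zero divisors: on the line joining the points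
  \<open>u\<close> and \<open>v\<close> both factors restrict to nonzero polynomials in one
  variable.\<close>

lemma poly_fun_mult_nonzero:
  fixes f g :: "(nat \<Rightarrow> complex) \<Rightarrow> complex"
  assumes "poly_fun n f" "poly_fun n g" "f u \<noteq> 0" "g v \<noteq> 0"
  shows "\<exists>w. f w * g w \<noteq> 0"
proof -
  obtain p where p: "\<And>t. f (\<lambda>i. u i + t * (v i - u i)) = poly p t"
    using poly_fun_on_line[OF assms(1)] by blast
  obtain r where r: "\<And>t. g (\<lambda>i. u i + t * (v i - u i)) = poly r t"
    using poly_fun_on_line[OF assms(2)] by blast
  have "p \<noteq> 0" using p[of 0] assms(3) by auto
  moreover have "r \<noteq> 0" using r[of 1] assms(4) by auto
  ultimately have "p * r \<noteq> 0" by simp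
  then obtain t where "poly (p * r) t \<noteq> 0" using poly_all_0_iff_0 by blast
  then show ?thesis using p[of t] r[of t] by (metis poly_mult)
qed

text \<open>The quantifier hidden in \<open>rat_eq\<close>, isolated so that several generic
  conditions can be intersected before an identity is checked pointwise.\<close>

definition generically :: "nat \<Rightarrow> ((nat \<Rightarrow> complex) \<Rightarrow> bool) \<Rightarrow> bool"
  where "generically n A \<longleftrightarrow> (\<exists>e :: (nat \<Rightarrow> complex) \<Rightarrow> complex.
    poly_fun n e \<and> (\<exists>u. e u \<noteq> 0) \<and> (\<forall>u. e u \<noteq> 0 \<longrightarrow> A u))"

lemma rat_eq_generically: "rat_eq n f g \<longleftrightarrow> generically n (\<lambda>u. f u = g u)"
  by (simp add: rat_eq_def generically_def)

lemma generically_mono: "generically n A \<Longrightarrow> (\<And>u. A u \<Longrightarrow> B u) \<Longrightarrow> generically n B"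
  unfolding generically_def by blast

lemma generically_True: "(\<And>u. A u) \<Longrightarrow> generically n A"
  unfolding generically_def by (intro exI[of _ "\<lambda>_. 1"]) (simp add: poly_fun.const)

lemma generically_conj:
  assumes "generically n A" "generically n B"
  shows "generically n (\<lambda>u. A u \<and> B u)"
proof -
  obtain e u where e: "poly_fun n e" "e u \<noteq> (0::complex)" "\<And>u. e u \<noteq> 0 \<Longrightarrow> A u"
    using assms(1) unfolding generically_def by blast
  obtain e' v where e': "poly_fun n e'" "e' v \<noteq> (0::complex)" "\<And>u. e' u \<noteq> 0 \<Longrightarrow> B u"
    using assms(2) unfolding generically_def by blast
  show ?thesis
    unfolding generically_def
    using poly_fun_mult_nonzero[OF e(1) e'(1) e(2) e'(2)] poly_fun_mult[OF e(1) e'(1)] e(3) e'(3)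
    by (intro exI[of _ "\<lambda>u. e u * e' u"]) simp
qed

lemma generically_ball:
  "finite S \<Longrightarrow> (\<And>a. a \<in> S \<Longrightarrow> generically n (A a)) \<Longrightarrow> generically n (\<lambda>u. \<forall>a\<in>S. A a u)"
proof (induction rule: finite_induct)
  case (insert x S)
  then have "generically n (\<lambda>u. A x u \<and> (\<forall>a\<in>S. A a u))" by (intro generically_conj) auto
  then show ?case by simp
qed (simp add: generically_True)

lemma generically_nonzero:
  "poly_fun n d \<Longrightarrow> d u \<noteq> (0::complex) \<Longrightarrow> generically n (\<lambda>u. d u \<noteq> 0)"
  unfolding generically_def by blast

lemma generically_coord_neq: "k \<in> {1..n} \<Longrightarrow> generically n (\<lambda>u. u k \<noteq> a)"
  using generically_nonzero[of n "\<lambda>u. u k - a" "\<lambda>_. a + 1"]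
  by (simp add: poly_fun_intros)

section \<open>Evaluation on a hyperplane and its algebraic rules\<close>

lemma evaluates_to_poly: "poly_fun n P \<Longrightarrow> evaluates_to n k a P (\<lambda>u. P (u(k := a)))"
  unfolding evaluates_to_def rat_eq_generically
  by (intro exI[of _ P] exI[of _ "\<lambda>_. 1"])
    (simp add: poly_fun.const generically_True scaleC_one)

lemma evaluates_to_const: "evaluates_to n k a (\<lambda>_. x) (\<lambda>_. x)"
  using evaluates_to_poly[OF poly_fun.const[of n x], of k a] by simp

lemma evaluates_to_divide:
  fixes p d :: "(nat \<Rightarrow> complex) \<Rightarrow> complex"
  assumes "poly_fun n p" "poly_fun n d" "d (u(k := a)) \<noteq> 0"
  shows "evaluates_to n k a (\<lambda>u. p u / d u) (\<lambda>u. p (u(k := a)) / d (u(k := a)))"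
  unfolding evaluates_to_def rat_eq_generically
  using assms
  by (intro exI[of _ p] exI[of _ d])
    (auto simp: generically_True scaleC_complex_def field_simps)

lemma evaluates_to_cong:
  assumes "evaluates_to n k a f g"
    and "generically n (\<lambda>u. f' u = f u)" "generically n (\<lambda>u. g' u = g u)"
  shows "evaluates_to n k a f' g'"
proof -
  obtain P d where Pd: "poly_fun n P" "poly_fun n (d :: (nat \<Rightarrow> complex) \<Rightarrow> complex)"
    "\<exists>u. d (u(k := a)) \<noteq> 0"
    "generically n (\<lambda>u. f u = inverse (d u) *\<^sub>C P u)"
    "generically n (\<lambda>u. g u = inverse (d (u(k := a))) *\<^sub>C P (u(k := a)))"
    using assms(1) unfolding evaluates_to_def rat_eq_generically by blast
  have "generically n (\<lambda>u. f' u = inverse (d u) *\<^sub>C P u)"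
    using generically_conj[OF Pd(4) assms(2)] by (rule generically_mono) simp
  moreover have "generically n (\<lambda>u. g' u = inverse (d (u(k := a))) *\<^sub>C P (u(k := a)))"
    using generically_conj[OF Pd(5) assms(3)] by (rule generically_mono) simp
  ultimately show ?thesis
    unfolding evaluates_to_def rat_eq_generically using Pd(1-3) by blast
qed

text \<open>Homogeneity in each argument is enough to pull both denominators out of
  \<open>b\<close>, and their product is not identically zero on the hyperplane. Leaving
  \<open>b\<close> abstract covers the product of the algebra and the action of scalars at once;
  sums need a common denominator instead.\<close>

lemma evaluates_to_combine:
  fixes b :: "'a::complex_algebra_1 \<Rightarrow> 'b::complex_algebra_1 \<Rightarrow> 'c::complex_algebra_1"
  assumes "evaluates_to n k a f g" "evaluates_to n k a f' g'"
    and poly: "\<And>P P'. poly_fun n P \<Longrightarrow> poly_fun n P' \<Longrightarrow> poly_fun n (\<lambda>u. b (P u) (P' u))"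
    and left: "\<And>r x y. b (r *\<^sub>C x) y = r *\<^sub>C b x y"
    and right: "\<And>r x y. b x (r *\<^sub>C y) = r *\<^sub>C b x y"
  shows "evaluates_to n k a (\<lambda>u. b (f u) (f' u)) (\<lambda>u. b (g u) (g' u))"
proof -
  obtain P d v where Pd: "poly_fun n P" "poly_fun n (d :: (nat \<Rightarrow> complex) \<Rightarrow> complex)"
    "d (v(k := a)) \<noteq> 0"
    "generically n (\<lambda>u. f u = inverse (d u) *\<^sub>C P u)"
    "generically n (\<lambda>u. g u = inverse (d (u(k := a))) *\<^sub>C P (u(k := a)))"
    using assms(1) unfolding evaluates_to_def rat_eq_generically by blast
  obtain P' d' v' where Pd': "poly_fun n P'" "poly_fun n (d' :: (nat \<Rightarrow> complex) \<Rightarrow> complex)"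
    "d' (v'(k := a)) \<noteq> 0"
    "generically n (\<lambda>u. f' u = inverse (d' u) *\<^sub>C P' u)"
    "generically n (\<lambda>u. g' u = inverse (d' (u(k := a))) *\<^sub>C P' (u(k := a)))"
    using assms(2) unfolding evaluates_to_def rat_eq_generically by blast
  have nz: "\<exists>w. d (w(k := a)) * d' (w(k := a)) \<noteq> 0"
    by (rule poly_fun_mult_nonzero[OF poly_fun_upd[OF Pd(2)] poly_fun_upd[OF Pd'(2)] Pd(3) Pd'(3)])
  show ?thesis
    unfolding evaluates_to_def rat_eq_generically
    by (intro exI[of _ "\<lambda>u. b (P u) (P' u)"] exI[of _ "\<lambda>u. d u * d' u"] conjI
        poly_fun_mult poly Pd(1,2) Pd'(1,2) nz generically_mono[OF generically_conj[OF Pd(4) Pd'(4)]]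
        generically_mono[OF generically_conj[OF Pd(5) Pd'(5)]])
      (simp_all add: left right scaleC_scaleC mult.commute)
qed

lemma evaluates_to_mult:
  "evaluates_to n k a f g \<Longrightarrow> evaluates_to n k a f' g' \<Longrightarrow>
    evaluates_to n k a (\<lambda>u. f u * f' u) (\<lambda>u. g u * g' u)"
  by (rule evaluates_to_combine)
    (simp_all add: poly_fun_mult mult_scaleC_left mult_scaleC_right)

lemma evaluates_to_scaleC:
  fixes f g :: "(nat \<Rightarrow> complex) \<Rightarrow> complex"
  shows "evaluates_to n k a f g \<Longrightarrow> evaluates_to n k a f' g' \<Longrightarrow>
    evaluates_to n k a (\<lambda>u. f u *\<^sub>C f' u) (\<lambda>u. g u *\<^sub>C g' u)"
  by (rule evaluates_to_combine)
    (simp_all add: poly_fun_scaleC_fun scaleC_scaleC scaleC_complex_def mult.commute)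

lemma evaluates_to_add:
  assumes "evaluates_to n k a f g" "evaluates_to n k a f' g'"
  shows "evaluates_to n k a (\<lambda>u. f u + f' u) (\<lambda>u. g u + g' u)"
proof -
  obtain P d v where Pd: "poly_fun n P" "poly_fun n (d :: (nat \<Rightarrow> complex) \<Rightarrow> complex)"
    "d (v(k := a)) \<noteq> 0"
    "generically n (\<lambda>u. f u = inverse (d u) *\<^sub>C P u)"
    "generically n (\<lambda>u. g u = inverse (d (u(k := a))) *\<^sub>C P (u(k := a)))"
    using assms(1) unfolding evaluates_to_def rat_eq_generically by blast
  obtain P' d' v' where Pd': "poly_fun n P'" "poly_fun n (d' :: (nat \<Rightarrow> complex) \<Rightarrow> complex)"
    "d' (v'(k := a)) \<noteq> 0"
    "generically n (\<lambda>u. f' u = inverse (d' u) *\<^sub>C P' u)"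
    "generically n (\<lambda>u. g' u = inverse (d' (u(k := a))) *\<^sub>C P' (u(k := a)))"
    using assms(2) unfolding evaluates_to_def rat_eq_generically by blast
  have dka: "poly_fun n (\<lambda>u. d (u(k := a)))" "poly_fun n (\<lambda>u. d' (u(k := a)))"
    using poly_fun_upd Pd(2) Pd'(2) by blast+
  have nz: "\<exists>w. d (w(k := a)) * d' (w(k := a)) \<noteq> 0"
    by (rule poly_fun_mult_nonzero[OF dka Pd(3) Pd'(3)])
  \<comment> \<open>The inverse is multiplicative even at 0, so products needed no such condition;
    bringing fractions to a common denominator does need nonzero denominators.\<close>
  have gen: "generically n (\<lambda>u. d u \<noteq> 0)" "generically n (\<lambda>u. d' u \<noteq> 0)"
    "generically n (\<lambda>u. d (u(k := a)) \<noteq> 0)" "generically n (\<lambda>u. d' (u(k := a)) \<noteq> 0)"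
    using generically_nonzero[OF Pd(2,3)] generically_nonzero[OF Pd'(2,3)]
      generically_nonzero[OF dka(1) Pd(3)] generically_nonzero[OF dka(2) Pd'(3)] by blast+
  have sum: "inverse r *\<^sub>C x + inverse r' *\<^sub>C y = inverse (r * r') *\<^sub>C (r' *\<^sub>C x + r *\<^sub>C y)"
    if "r \<noteq> 0" "r' \<noteq> 0" for r r' :: complex and x y :: 'a
  proof -
    have "inverse (r * r') * r' = inverse r" "inverse (r * r') * r = inverse r'"
      using that by simp_all
    then show ?thesis by (simp only: scaleC_add_right scaleC_scaleC)
  qed
  have "generically n (\<lambda>u. f u + f' u = inverse (d u * d' u) *\<^sub>C (d' u *\<^sub>C P u + d u *\<^sub>C P' u))"
    using generically_conj[OF generically_conj[OF Pd(4) Pd'(4)] generically_conj[OF gen(1,2)]]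
    by (rule generically_mono) (simp add: sum del: inverse_mult_distrib)
  moreover have "generically n (\<lambda>u. g u + g' u = inverse (d (u(k := a)) * d' (u(k := a))) *\<^sub>C
      (d' (u(k := a)) *\<^sub>C P (u(k := a)) + d (u(k := a)) *\<^sub>C P' (u(k := a))))"
    using generically_conj[OF generically_conj[OF Pd(5) Pd'(5)] generically_conj[OF gen(3,4)]]
    by (rule generically_mono) (simp add: sum del: inverse_mult_distrib)
  ultimately show ?thesis
    unfolding evaluates_to_def rat_eq_generically
    using nz Pd(1,2) Pd'(1,2)
    by (intro exI[of _ "\<lambda>u. d' u *\<^sub>C P u + d u *\<^sub>C P' u"] exI[of _ "\<lambda>u. d u * d' u"])
      (simp add: poly_fun_mult poly_fun.add poly_fun_scaleC_fun)
qed

lemma evaluates_to_sum: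
  "finite S \<Longrightarrow> (\<And>s. s \<in> S \<Longrightarrow> evaluates_to n k a (f s) (g s)) \<Longrightarrow>
    evaluates_to n k a (\<lambda>u. \<Sum>s\<in>S. f s u) (\<lambda>u. \<Sum>s\<in>S. g s u)"
  by (induction rule: finite_induct) (simp_all add: evaluates_to_const evaluates_to_add)

lemma evaluates_to_prod:
  fixes f g :: "'s \<Rightarrow> (nat \<Rightarrow> complex) \<Rightarrow> complex"
  shows "finite S \<Longrightarrow> (\<And>s. s \<in> S \<Longrightarrow> evaluates_to n k a (f s) (g s)) \<Longrightarrow>
    evaluates_to n k a (\<lambda>u. \<Prod>s\<in>S. f s u) (\<lambda>u. \<Prod>s\<in>S. g s u)"
  by (induction rule: finite_induct) (simp_all add: evaluates_to_const evaluates_to_mult)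

lemma evaluates_to_prod_list:
  "(\<And>s. s \<in> set xs \<Longrightarrow> evaluates_to n k a (f s) (g s)) \<Longrightarrow>
    evaluates_to n k a (\<lambda>u. prod_list (map (\<lambda>s. f s u) xs)) (\<lambda>u. prod_list (map (\<lambda>s. g s u) xs))"
  by (induction xs) (simp_all add: evaluates_to_const evaluates_to_mult)

section \<open>The relations of the presentation\<close>

lemma poly_mapping_add_induct [case_names zero single add]:
  fixes p :: "'k \<Rightarrow>\<^sub>0 'c::comm_monoid_add"
  assumes "P 0" and single: "\<And>k a. P (Poly_Mapping.single k a)"
    and add: "\<And>p r. P p \<Longrightarrow> P r \<Longrightarrow> P (p + r)"
  shows "P p"
proof (induction p rule: update_induct)
  case (update p k a)
  have "Poly_Mapping.update k a p = p + Poly_Mapping.single k a"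
    using update(1)
    by (intro poly_mapping_eqI) (auto simp: lookup_update lookup_add lookup_single in_keys_iff)
  then show ?case using add[OF update(3) single] by simp
qed (fact assms(1))

lemma free_eval_single:
  "free_eval f (Poly_Mapping.single w a) = a *\<^sub>C prod_list (map f (letters w))"
  by (simp add: free_eval_def)

lemma free_eval_add: "free_eval f (p + r) = free_eval f p + free_eval f r"
  unfolding free_eval_def
  by (rule setsum_keys_plus_distrib[where f = "\<lambda>w a. a *\<^sub>C prod_list (map f (letters w))"])
    (simp_all add: scaleC_add_left)

lemma free_eval_zero: "free_eval f 0 = 0"
  by (simp add: free_eval_def)

lemma free_eval_mult: "free_eval f (p * r) = free_eval f p * free_eval f r"
proof (induction p rule: poly_mapping_add_induct)
  case (single w a)
  show ?case
    by (induction r rule: poly_mapping_add_induct)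
      (simp_all add: free_eval_zero free_eval_add free_eval_single mult_single plus_word_def
        mult_scaleC_left mult_scaleC_right distrib_left)
qed (simp_all add: free_eval_zero free_eval_add distrib_right)

lemma free_eval_diff: "free_eval f (p - r) = free_eval f p - free_eval f r"
  using free_eval_add[of f "p - r" r] by (simp add: algebra_simps)

lemma free_eval_gen: "free_eval f (free_gen g) = f g"
  by (simp add: free_gen_def free_eval_single scaleC_one)

lemma free_eval_const: "free_eval f (free_const a) = a *\<^sub>C 1"
  by (simp add: free_const_def free_eval_single zero_word_def)

lemma free_eval_one: "free_eval f 1 = 1"
  using free_eval_const[of f 1] by (simp add: free_const_def scaleC_one)

lemmas free_eval_simps =
  free_eval_add free_eval_diff free_eval_mult free_eval_gen free_eval_const free_eval_one

lemma free_on_diff: "p \<in> free_on X \<Longrightarrow> r \<in> free_on X \<Longrightarrow> p - r \<in> free_on X"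
  using keys_diff[of p r] unfolding free_on_def by blast

lemma free_on_mult:
  assumes "p \<in> free_on X" "r \<in> free_on X"
  shows "p * r \<in> free_on X"
  unfolding free_on_def
proof (intro CollectI ballI)
  fix w assume "w \<in> Poly_Mapping.keys (p * r)"
  then obtain a b where "w = a + b" "a \<in> Poly_Mapping.keys p" "b \<in> Poly_Mapping.keys r"
    using keys_mult[of p r] by blast
  then show "set (letters w) \<subseteq> X"
    using assms by (auto simp: free_on_def plus_word_def)
qed

lemma free_on_gen: "g \<in> X \<Longrightarrow> free_gen g \<in> free_on X"
  by (simp add: free_on_def free_gen_def)

lemma free_on_const: "free_const a \<in> free_on X"
  by (simp add: free_on_def free_const_def zero_word_def)

lemma free_on_one: "1 \<in> free_on X"
  using free_on_const[of 1 X] by (simp add: free_const_def)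

lemma free_on_kappa:
  "Gen i \<in> X \<Longrightarrow> GenInv i \<in> X \<Longrightarrow> free_kappa q i \<in> free_on X"
  by (simp add: free_kappa_def free_on_diff free_on_mult free_on_gen free_on_const free_on_one)

lemma presented_by_relator:
  assumes "presented_by X R f" "r \<in> R" "r \<in> free_on X"
  shows "free_eval f r = 0"
proof -
  have "r \<in> two_sided_ideal (free_on X) hull R"
    using assms(2) by (rule hull_inc)
  with assms(1,3) show ?thesis unfolding presented_by_def by blast
qed

text \<open>Collects the relations inside the algebra itself, so that the identities below are
  derived without the free algebra. Neighbouring indices are written \<open>i\<close> and
  \<open>Suc i\<close>, which avoids subtraction of natural numbers.\<close>

locale bmw_relations =
  fixes n :: nat and q \<nu> :: complex and T :: "nat \<Rightarrow> 'a::complex_algebra_1"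
  assumes q_nonzero: "q \<noteq> 0" and nu_nonzero: "\<nu> \<noteq> 0" and q_generic: "q - inverse q \<noteq> 0"
    and T_inv_right: "1 \<le> i \<Longrightarrow> i < n \<Longrightarrow> T i * ring_inv (T i) = 1"
    and T_inv_left: "1 \<le> i \<Longrightarrow> i < n \<Longrightarrow> ring_inv (T i) * T i = 1"
    and braid: "1 \<le> i \<Longrightarrow> Suc i < n \<Longrightarrow> T i * T (Suc i) * T i = T (Suc i) * T i * T (Suc i)"
    and far_commute: "1 \<le> i \<Longrightarrow> Suc i < j \<Longrightarrow> j < n \<Longrightarrow> T i * T j = T j * T i"
    and kappa_T: "1 \<le> i \<Longrightarrow> i < n \<Longrightarrow> kappa q T i * T i = \<nu> *\<^sub>C kappa q T i"
    and T_kappa: "1 \<le> i \<Longrightarrow> i < n \<Longrightarrow> T i * kappa q T i = \<nu> *\<^sub>C kappa q T i"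
    and kappa_T_prev_kappa: "1 \<le> i \<Longrightarrow> Suc i < n \<Longrightarrow>
      kappa q T (Suc i) * T i * kappa q T (Suc i) = inverse \<nu> *\<^sub>C kappa q T (Suc i)"
    and kappa_Tinv_prev_kappa: "1 \<le> i \<Longrightarrow> Suc i < n \<Longrightarrow>
      kappa q T (Suc i) * ring_inv (T i) * kappa q T (Suc i) = \<nu> *\<^sub>C kappa q T (Suc i)"
    and kappa_Tinv_next_kappa: "1 \<le> i \<Longrightarrow> Suc i < n \<Longrightarrow>
      kappa q T i * ring_inv (T (Suc i)) * kappa q T i = \<nu> *\<^sub>C kappa q T i"

lemma is_bmw_relations:
  fixes T :: "nat \<Rightarrow> 'a::complex_algebra_1"
  assumes bmw: "is_bmw n q \<nu> T" and "q \<noteq> 0" "\<nu> \<noteq> 0" "q - inverse q \<noteq> 0"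
  shows "bmw_relations n q \<nu> T"
proof -
  define f where "f = (\<lambda>g. case g of Gen i \<Rightarrow> T i | GenInv i \<Rightarrow> ring_inv (T i))"
  have rel: "free_eval f r = 0" if "r \<in> bmw_relators n q \<nu>" "r \<in> free_on (bmw_gens n)" for r
    using presented_by_relator[OF bmw[unfolded is_bmw_def, folded f_def] that] .
  have f: "f (Gen i) = T i" "f (GenInv i) = ring_inv (T i)" for i
    by (simp_all add: f_def)
  have k: "free_eval f (free_kappa q i) = kappa q T i" for i
    by (simp add: free_kappa_def kappa_def free_eval_simps f mult_scaleC_left)
  have g: "free_gen (Gen i) \<in> free_on (bmw_gens n)" "free_gen (GenInv i) \<in> free_on (bmw_gens n)"
    "free_kappa q i \<in> free_on (bmw_gens n)" if "1 \<le> i" "i < n" for i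
    using that by (auto intro!: free_on_gen free_on_kappa simp: bmw_gens_def)
  note memb = free_on_diff free_on_mult free_on_one free_on_const g
  note ev = free_eval_simps f k mult_scaleC_left
  let ?t = "\<lambda>i. free_gen (Gen i)" and ?t' = "\<lambda>i. free_gen (GenInv i)"
  show ?thesis
  proof
    fix i assume i: "1 \<le> i" "i < n"
    \<comment> \<open>The formal inverse generator is interpreted by \<open>ring_inv (T i)\<close>;
      this relator and the next one turn that definite description into a genuine two-sided
      inverse.\<close>
    have "free_eval f (?t i * ?t' i - 1) = 0"
      using i by (intro rel memb) (auto simp: bmw_relators_def Let_def)
    then show "T i * ring_inv (T i) = 1" by (simp add: ev)
    have "free_eval f (?t' i * ?t i - 1) = 0"
      using i by (intro rel memb) (auto simp: bmw_relators_def Let_def)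
    then show "ring_inv (T i) * T i = 1" by (simp add: ev)
    have "free_eval f (free_kappa q i * ?t i - free_const \<nu> * free_kappa q i) = 0"
      using i by (intro rel memb) (auto simp: bmw_relators_def Let_def)
    then show "kappa q T i * T i = \<nu> *\<^sub>C kappa q T i" by (simp add: ev)
    have "free_eval f (?t i * free_kappa q i - free_const \<nu> * free_kappa q i) = 0"
      using i by (intro rel memb) (auto simp: bmw_relators_def Let_def)
    then show "T i * kappa q T i = \<nu> *\<^sub>C kappa q T i" by (simp add: ev)
  next
    fix i assume i: "1 \<le> i" "Suc i < n"
    then have i': "1 \<le> i" "i < n" "1 \<le> Suc i" "Suc i < n" by simp_all
    have "free_eval f (?t i * ?t (i + 1) * ?t i - ?t (i + 1) * ?t i * ?t (i + 1)) = 0"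
      unfolding Suc_eq_plus1[symmetric]
      using i by (intro rel memb i') (simp only: bmw_relators_def Let_def Suc_eq_plus1, blast)
    then show "T i * T (Suc i) * T i = T (Suc i) * T i * T (Suc i)" by (simp add: ev)
    have i'': "1 \<le> i \<and> i + 1 < n" "2 \<le> Suc i \<and> Suc i < n" using i by simp_all
    have "free_eval f (free_kappa q (Suc i) * ?t (Suc i - 1) * free_kappa q (Suc i)
        - free_const (inverse \<nu>) * free_kappa q (Suc i)) = 0"
    proof (rule rel)
      show "free_kappa q (Suc i) * ?t (Suc i - 1) * free_kappa q (Suc i)
          - free_const (inverse \<nu>) * free_kappa q (Suc i) \<in> bmw_relators n q \<nu>"
        unfolding bmw_relators_def Let_def using i'' by blast
    qed (intro memb; use i in simp)
    then show "kappa q T (Suc i) * T i * kappa q T (Suc i) = inverse \<nu> *\<^sub>C kappa q T (Suc i)"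
      by (simp add: ev)
    have "free_eval f (free_kappa q (Suc i) * ?t' (Suc i - 1) * free_kappa q (Suc i)
        - free_const \<nu> * free_kappa q (Suc i)) = 0"
    proof (rule rel)
      show "free_kappa q (Suc i) * ?t' (Suc i - 1) * free_kappa q (Suc i)
          - free_const \<nu> * free_kappa q (Suc i) \<in> bmw_relators n q \<nu>"
        unfolding bmw_relators_def Let_def using i'' by blast
    qed (intro memb; use i in simp)
    then show "kappa q T (Suc i) * ring_inv (T i) * kappa q T (Suc i) = \<nu> *\<^sub>C kappa q T (Suc i)"
      by (simp add: ev)
    have "free_eval f (free_kappa q i * ?t' (i + 1) * free_kappa q i
        - free_const \<nu> * free_kappa q i) = 0"
    proof (rule rel)
      show "free_kappa q i * ?t' (i + 1) * free_kappa q i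
          - free_const \<nu> * free_kappa q i \<in> bmw_relators n q \<nu>"
        unfolding bmw_relators_def Let_def using i'' by blast
    qed (intro memb; use i in simp)
    then show "kappa q T i * ring_inv (T (Suc i)) * kappa q T i = \<nu> *\<^sub>C kappa q T i"
      by (simp add: ev)
  next
    fix i j assume ij: "1 \<le> i" "Suc i < j" "j < n"
    have "free_eval f (?t i * ?t j - ?t j * ?t i) = 0"
    proof (rule rel)
      have "1 \<le> i \<and> i < n \<and> 1 \<le> j \<and> j < n \<and> \<bar>int i - int j\<bar> > 1"
        using ij by linarith
      then show "?t i * ?t j - ?t j * ?t i \<in> bmw_relators n q \<nu>"
        unfolding bmw_relators_def Let_def by blast
    qed (intro memb; use ij in simp)
    then show "T i * T j = T j * T i" by (simp add: ev)
  qed (fact assms)+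
qed

section \<open>Joint faithfulness of the irreducible representations\<close>

lemma left_ideal_scaleC: "left_ideal UNIV N \<Longrightarrow> x \<in> N \<Longrightarrow> a *\<^sub>C x \<in> N"
  for N :: "'a::complex_algebra_1 set"
  unfolding left_ideal_def using mult_scaleC_left[of a 1 x] by (metis UNIV_I mult_1)

lemma left_ideal_subspace: "left_ideal UNIV N \<Longrightarrow> complex_vector.subspace N"
  for N :: "'a::complex_algebra_1 set"
  using left_ideal_scaleC[of N] by (simp add: complex_vector.subspace_def left_ideal_def)

text \<open>A basis indexed by natural numbers below \<open>d\<close>, because the classification in
  \<open>labelled_irreps\<close> speaks about matrix representations indexed by sets of natural
  numbers.\<close>

definition coordinates ::
    "'a::complex_algebra_1 set \<Rightarrow> nat \<Rightarrow> (nat \<Rightarrow> 'a) \<Rightarrow> ('a \<Rightarrow> nat \<Rightarrow> complex) \<Rightarrow> bool"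
  where "coordinates N d h co \<longleftrightarrow> complex_vector.subspace N \<and> (\<forall>i<d. h i \<in> N) \<and>
    (\<forall>v\<in>N. (\<Sum>i<d. co v i *\<^sub>C h i) = v) \<and> (\<forall>f. \<forall>i<d. co (\<Sum>k<d. f k *\<^sub>C h k) i = f i)"

lemma coordinates_exist:
  fixes N :: "'a::complex_algebra_1 set"
  assumes "finite S" "complex_vector.span S = (UNIV :: 'a set)" "complex_vector.subspace N"
  obtains d h co where "coordinates N d h co"
proof -
  obtain D where D: "D \<subseteq> N" "complex_vector.independent D" "N \<subseteq> complex_vector.span D"
    by (rule complex_vector.basis_exists[of N])
  have span: "complex_vector.span D = N"
    using D assms(3) by (simp add: complex_vector.span_subspace)
  have "finite D"
    using complex_vector.independent_span_bound[OF assms(1) D(2)] assms(2) by simp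
  then obtain h where h: "bij_betw h {..<card D} D"
    using ex_bij_betw_nat_finite lessThan_atLeast0 by metis
  let ?co = "\<lambda>v i. complex_vector.representation D v (h i)"
  have "(\<Sum>i<card D. ?co v i *\<^sub>C h i) = v" if "v \<in> N" for v
    using sum.reindex_bij_betw[OF h, of "\<lambda>b. complex_vector.representation D v b *\<^sub>C b"]
      complex_vector.sum_representation_eq[OF D(2) _ \<open>finite D\<close> order_refl] that span by simp
  moreover have "?co (\<Sum>k<card D. f k *\<^sub>C h k) i = f i" if "i < card D" for f i
  proof -
    \<comment> \<open>The coefficients are moved from indices to the basis \<open>D\<close> and
      extended by 0, so that uniqueness of the basis representation applies.\<close>
    define g where "g b = (if b \<in> D then f (inv_into {..<card D} h b) else 0)" for b
    have hD: "h k \<in> D" if "k < card D" for k using h that by (auto simp: bij_betw_def)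
    have gh: "g (h k) = f k" if "k < card D" for k
      using h hD that by (simp add: g_def bij_betw_inv_into_left)
    have "complex_vector.representation D (\<Sum>k<card D. f k *\<^sub>C h k) = g"
    proof (rule complex_vector.representation_eqI[OF D(2)])
      show "(\<Sum>k<card D. f k *\<^sub>C h k) \<in> complex_vector.span D"
        by (intro complex_vector.span_sum complex_vector.span_scale complex_vector.span_base)
          (use hD in auto)
      show "b \<in> D" if "g b \<noteq> 0" for b using that by (auto simp: g_def split: if_splits)
      show "finite {b. g b \<noteq> 0}"
        by (rule finite_subset[OF _ \<open>finite D\<close>]) (auto simp: g_def)
      have "(\<Sum>b | g b \<noteq> 0. g b *\<^sub>C b) = (\<Sum>b\<in>D. g b *\<^sub>C b)"
        by (rule sum.mono_neutral_left) (use \<open>finite D\<close> in \<open>auto simp: g_def\<close>)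
      also have "\<dots> = (\<Sum>k<card D. f k *\<^sub>C h k)"
        using sum.reindex_bij_betw[OF h, of "\<lambda>b. g b *\<^sub>C b"] gh by simp
      finally show "(\<Sum>b | g b \<noteq> 0. g b *\<^sub>C b) = (\<Sum>k<card D. f k *\<^sub>C h k)" .
    qed
    then show ?thesis using gh that by simp
  qed
  moreover have "\<forall>i<card D. h i \<in> N" using h D(1) by (auto simp: bij_betw_def)
  ultimately have "coordinates N (card D) h ?co"
    using assms(3) unfolding coordinates_def by (intro conjI allI ballI impI) simp_all
  then show ?thesis by (rule that)
qed

lemma coordinates_linear:
  assumes co: "coordinates N d h co" and i: "i < d"
  shows "v \<in> N \<Longrightarrow> w \<in> N \<Longrightarrow> co (v + w) i = co v i + co w i"
    and "v \<in> N \<Longrightarrow> co (a *\<^sub>C v) i = a * co v i"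
    and "(\<And>k. k \<in> K \<Longrightarrow> g k \<in> N) \<Longrightarrow>
      co (\<Sum>k\<in>K. f k *\<^sub>C g k) i = (\<Sum>k\<in>K. f k * co (g k) i)"
proof -
  have eq: "(\<Sum>k<d. co v k *\<^sub>C h k) = v" if "v \<in> N" for v
    using co that by (simp add: coordinates_def)
  have uniq: "co (\<Sum>k<d. f k *\<^sub>C h k) i = f i" for f
    using co i by (simp add: coordinates_def)
  have sub: "complex_vector.subspace N" using co by (simp add: coordinates_def)
  show add: "co (v + w) i = co v i + co w i" if "v \<in> N" "w \<in> N" for v w
    using uniq[of "\<lambda>k. co v k + co w k"] eq that by (simp add: scaleC_add_left sum.distrib)
  show scale: "co (a *\<^sub>C v) i = a * co v i" if "v \<in> N" for a v
  proof -
    have "(\<Sum>k<d. (a * co v k) *\<^sub>C h k) = a *\<^sub>C v"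
      using arg_cong[OF eq[OF that], of "\<lambda>v. a *\<^sub>C v"]
      by (simp add: complex_vector.scale_sum_right)
    then show ?thesis using uniq[of "\<lambda>k. a * co v k"] by simp
  qed
  have "co 0 i = 0" using uniq[of "\<lambda>_. 0"] by simp
  then show "co (\<Sum>k\<in>K. f k *\<^sub>C g k) i = (\<Sum>k\<in>K. f k * co (g k) i)"
    if "\<And>k. k \<in> K \<Longrightarrow> g k \<in> N"
    using that
  proof (induction K rule: infinite_finite_induct)
    case (insert k K)
    then have "f k *\<^sub>C g k \<in> N" "(\<Sum>k\<in>K. f k *\<^sub>C g k) \<in> N"
      by (auto intro!: complex_vector.subspace_sum[OF sub] complex_vector.subspace_scale[OF sub])
    then show ?case using insert by (simp add: add scale)
  qed auto
qed

lemma left_regular_rep: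
  fixes N :: "'a::complex_algebra_1 set"
  assumes N: "left_ideal UNIV N" and co: "coordinates N d h co"
  shows "matrix_rep UNIV {..<d} (\<lambda>x i j. co (x * h j) i)"
proof -
  have h: "h j \<in> N" if "j < d" for j using co that by (simp add: coordinates_def)
  have xh: "x * h j \<in> N" if "j < d" for x j using N h[OF that] by (simp add: left_ideal_def)
  have "co (h j) i = of_bool (i = j)" if "i < d" "j < d" for i j
  proof -
    have "(\<Sum>k<d. of_bool (k = j) *\<^sub>C h k) = (\<Sum>k<d. if k = j then h k else 0)"
      by (rule sum.cong) (simp_all add: scaleC_one)
    also have "\<dots> = h j" using that by simp
    finally show ?thesis
      using co that unfolding coordinates_def by metis
  qed
  moreover have "co (x * y * h j) i = (\<Sum>k<d. co (x * h k) i * co (y * h j) k)"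
    if "i < d" "j < d" for x y i j
  proof -
    have "(\<Sum>k<d. co (y * h j) k *\<^sub>C h k) = y * h j"
      using co xh[OF that(2)] by (simp add: coordinates_def)
    then have "x * y * h j = x * (\<Sum>k<d. co (y * h j) k *\<^sub>C h k)"
      by (simp add: mult.assoc)
    also have "\<dots> = (\<Sum>k<d. co (y * h j) k *\<^sub>C (x * h k))"
      by (simp add: sum_distrib_left mult_scaleC_right)
    finally show ?thesis
      using that xh coordinates_linear(3)[OF co that(1), of "{..<d}" "\<lambda>k. x * h k"]
      by (simp add: mult.commute)
  qed
  ultimately show ?thesis
    by (simp add: matrix_rep_def mult_scaleC_left distrib_right xh coordinates_linear[OF co])
qed

text \<open>The map \<open>comb\<close> from coordinate vectors to \<open>N\<close> turns the matrix
  action into left multiplication. It therefore sends an invariant subspace to a left ideal inside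
  \<open>N\<close>, and minimality leaves only 0 and \<open>N\<close>; injectivity of
  \<open>comb\<close> on \<open>vectors {..<d}\<close> carries the conclusion back.\<close>

lemma minimal_left_ideal_irreducible:
  fixes N :: "'a::complex_algebra_1 set"
  assumes N: "left_ideal UNIV N" "N \<noteq> {0}" and co: "coordinates N d h co"
    and minimal: "\<And>L. left_ideal UNIV L \<Longrightarrow> L \<subseteq> N \<Longrightarrow> L \<noteq> {0} \<Longrightarrow> L = N"
  shows "irreducible_rep UNIV {..<d} (\<lambda>x i j. co (x * h j) i)"
proof -
  let ?\<sigma> = "\<lambda>x i j. co (x * h j) i"
  define comb where "comb f = (\<Sum>k<d. f k *\<^sub>C h k)" for f
  have h: "h j \<in> N" if "j < d" for j using co that by (simp add: coordinates_def)
  have sub: "complex_vector.subspace N" using co by (simp add: coordinates_def)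
  have comb_co: "comb (co v) = v" if "v \<in> N" for v
    using co that by (simp add: coordinates_def comb_def)
  have co_comb: "co (comb f) i = f i" if "i < d" for f i
    using co that by (simp add: coordinates_def comb_def)
  have comb_N: "comb f \<in> N" for f
    unfolding comb_def
    by (intro complex_vector.subspace_sum[OF sub] complex_vector.subspace_scale[OF sub] h) simp
  have comb_cong: "comb f = comb g" if "\<And>i. i < d \<Longrightarrow> f i = g i" for f g
    using that by (simp add: comb_def)
  have comb_app: "comb (mat_apply {..<d} (?\<sigma> x) f) = x * comb f" for x f
  proof -
    have xN: "x * comb f \<in> N" and xh: "\<And>j. j < d \<Longrightarrow> x * h j \<in> N"
      using N comb_N h by (auto simp: left_ideal_def)
    have "mat_apply {..<d} (?\<sigma> x) f i = co (x * comb f) i" if "i < d" for i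
    proof -
      have "x * comb f = (\<Sum>k<d. f k *\<^sub>C (x * h k))"
        by (simp add: comb_def sum_distrib_left mult_scaleC_right)
      then show ?thesis
        using that xh coordinates_linear(3)[OF co that, of "{..<d}" "\<lambda>k. x * h k"]
        by (simp add: mat_apply_def mult.commute)
    qed
    then have "comb (mat_apply {..<d} (?\<sigma> x) f) = comb (co (x * comb f))"
      by (rule comb_cong)
    then show ?thesis using comb_co[OF xN] by simp
  qed
  have eqI: "f = g" if "f \<in> vectors {..<d}" "g \<in> vectors {..<d}" "comb f = comb g" for f g
  proof
    fix i show "f i = g i"
      using that co_comb[of i f] co_comb[of i g] by (cases "i < d") (auto simp: vectors_def)
  qed
  have "W = {\<lambda>_. 0} \<or> W = vectors {..<d}" if W: "invariant_subspace UNIV {..<d} ?\<sigma> W" for W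
  proof -
    have W_vec: "W \<subseteq> vectors {..<d}" using W by (simp add: invariant_subspace_def)
    have zero: "comb (\<lambda>_. 0) = 0" by (simp add: comb_def)
    have zW: "(\<lambda>_. 0) \<in> W" using W by (simp add: invariant_subspace_def)
    have "left_ideal UNIV (comb ` W)"
      unfolding left_ideal_def
    proof (intro conjI ballI)
      show "0 \<in> comb ` W" using zero zW by (metis imageI)
    next
      fix x y assume "x \<in> comb ` W" "y \<in> comb ` W"
      then obtain f g where "f \<in> W" "g \<in> W" "x = comb f" "y = comb g" by blast
      then show "x + y \<in> comb ` W"
        using W
        by (intro image_eqI[of _ _ "\<lambda>i. f i + g i"])
          (auto simp: invariant_subspace_def comb_def scaleC_add_left sum.distrib)
    next
      fix b :: 'a and x assume "x \<in> comb ` W"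
      then obtain f where "f \<in> W" "x = comb f" by blast
      then show "b * x \<in> comb ` W"
        using W comb_app[of b f, symmetric] unfolding invariant_subspace_def by blast
    qed simp
    moreover have "comb ` W \<subseteq> N" using comb_N by blast
    ultimately consider "comb ` W = {0}" | "comb ` W = N" using minimal by blast
    then show ?thesis
    proof cases
      case 1
      have "f = (\<lambda>_. 0)" if "f \<in> W" for f
        using 1 that zero zW W_vec by (intro eqI) auto
      then show ?thesis using zW by blast
    next
      case 2
      have "f \<in> W" if f: "f \<in> vectors {..<d}" for f
      proof -
        obtain g where g: "g \<in> W" "comb f = comb g" using 2 comb_N[of f] by blast
        then have "f = g" using f W_vec by (intro eqI) auto
        then show ?thesis using g by simp
      qed
      then show ?thesis using W_vec by blast
    qed
  qed
  moreover have "{..<d} \<noteq> {}"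
  proof
    assume "{..<d} = {}"
    then have "v = 0" if "v \<in> N" for v using comb_co[OF that] by (simp add: comb_def)
    then show False using N by (auto simp: left_ideal_def)
  qed
  ultimately show ?thesis
    using left_regular_rep[OF N(1) co] by (simp add: irreducible_rep_def)
qed

text \<open>The intertwining relation gives \<sigma>(x) = Q \<tau>(x) P, once Q P = 1 is inserted on
  the left.\<close>

lemma equivalent_reps_vanish:
  assumes "equivalent_reps B I \<sigma> J \<tau>" "x \<in> B" "\<forall>i\<in>J. \<forall>j\<in>J. \<tau> x i j = 0"
    and "matrix_rep B I \<sigma>" "i \<in> I" "k \<in> I"
  shows "\<sigma> x i k = 0"
proof -
  obtain P Q where PQ: "\<forall>i\<in>I. \<forall>k\<in>I. (\<Sum>j\<in>J. Q i j * P j k) = of_bool (i = k)"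
    "\<forall>x\<in>B. \<forall>j\<in>J. \<forall>i\<in>I. (\<Sum>k\<in>I. P j k * \<sigma> x k i) = (\<Sum>k\<in>J. \<tau> x j k * P k i)"
    using assms(1) unfolding equivalent_reps_def by blast
  have fin: "finite I" using assms(4) by (simp add: matrix_rep_def)
  have "(\<Sum>l\<in>I. P j l * \<sigma> x l k) = 0" if "j \<in> J" for j
  proof -
    have "(\<Sum>l\<in>I. P j l * \<sigma> x l k) = (\<Sum>l\<in>J. \<tau> x j l * P l k)"
      using PQ(2) assms(2) that assms(6) by blast
    also have "\<dots> = 0" using assms(3) that by simp
    finally show ?thesis .
  qed
  then have "(\<Sum>j\<in>J. Q i j * (\<Sum>l\<in>I. P j l * \<sigma> x l k)) = 0" by simp
  moreover have "(\<Sum>j\<in>J. Q i j * (\<Sum>l\<in>I. P j l * \<sigma> x l k)) =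
      (\<Sum>l\<in>I. (\<Sum>j\<in>J. Q i j * P j l) * \<sigma> x l k)"
    unfolding sum_distrib_left sum_distrib_right
    by (subst sum.swap) (simp add: mult.assoc)
  moreover have "\<dots> = (\<Sum>l\<in>I. if l = i then \<sigma> x l k else 0)"
    by (rule sum.cong) (use PQ(1) assms(5) in auto)
  ultimately show ?thesis using fin assms(5) by simp
qed

text \<open>A minimal left ideal in the common kernel would be generated by an idempotent \<open>e\<close>; being an
  irreducible module, it is annihilated by \<open>e\<close>, whence \<open>e = e * e = 0\<close>.\<close>

lemma semisimple_irreps_faithful:
  fixes \<rho> :: "'l \<Rightarrow> 'a::complex_algebra_1 \<Rightarrow> 'i \<Rightarrow> 'i \<Rightarrow> complex"
  assumes ss: "semisimple (UNIV :: 'a set)"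
    and rep: "\<And>l. l \<in> L \<Longrightarrow> matrix_rep UNIV (I l) (\<rho> l)"
    and all: "\<And>(J :: nat set) \<sigma>. irreducible_rep (UNIV :: 'a set) J \<sigma> \<Longrightarrow>
      \<exists>l\<in>L. equivalent_reps UNIV J \<sigma> (I l) (\<rho> l)"
    and zero: "\<And>l i j. l \<in> L \<Longrightarrow> i \<in> I l \<Longrightarrow> j \<in> I l \<Longrightarrow> \<rho> l x i j = 0"
  shows "x = 0"
proof (rule ccontr)
  assume "x \<noteq> 0"
  define J where "J = {x. \<forall>l\<in>L. \<forall>i\<in>I l. \<forall>j\<in>I l. \<rho> l x i j = 0}"
  have "\<rho> l 0 i j = 0" if "l \<in> L" "i \<in> I l" "j \<in> I l" for l i j
  proof -
    have "\<forall>a. \<forall>x. \<forall>i\<in>I l. \<forall>j\<in>I l. \<rho> l (a *\<^sub>C x) i j = a * \<rho> l x i j"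
      using rep[OF that(1)] by (simp add: matrix_rep_def)
    then have "\<rho> l (0 *\<^sub>C 0) i j = 0 * \<rho> l 0 i j" using that by blast
    then show ?thesis by simp
  qed
  then have J: "left_ideal UNIV J"
    using rep by (simp add: left_ideal_def J_def matrix_rep_def)
  have xJ: "x \<in> J" using zero by (simp add: J_def)
  obtain S where S: "finite S" "UNIV = complex_vector.span (S :: 'a set)"
    using conjunct1[OF ss[unfolded semisimple_def]] by (elim exE conjE)
  obtain D :: "'a set" where D: "complex_vector.independent D" "UNIV \<subseteq> complex_vector.span D"
    by (rule complex_vector.basis_exists[of UNIV])
  have "finite D"
    using complex_vector.independent_span_bound[OF S(1) D(1)] S(2)[symmetric] by simp
  interpret fd: finite_dimensional_vector_space "scaleC :: complex \<Rightarrow> 'a \<Rightarrow> 'a" D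
    by unfold_locales (use D \<open>finite D\<close> in auto)
  \<comment> \<open>The common kernel \<open>J\<close> is a nonzero left ideal, as it contains
    \<open>x\<close>. A nonzero left ideal of least dimension inside \<open>J\<close> is then
    minimal among all nonzero left ideals.\<close>
  define C where "C N \<longleftrightarrow> left_ideal UNIV N \<and> N \<subseteq> J \<and> N \<noteq> {0}" for N
  have "C J" using J xJ \<open>x \<noteq> 0\<close> by (auto simp: C_def)
  then obtain N where "C N" and least: "\<And>L. C L \<Longrightarrow> complex_vector.dim N \<le> complex_vector.dim L"
    using arg_min_nat_lemma[of C J complex_vector.dim] by blast
  then have N: "left_ideal UNIV N" "N \<subseteq> J" "N \<noteq> {0}" by (simp_all add: C_def)
  have minimal: "L = N" if "left_ideal UNIV L" "L \<subseteq> N" "L \<noteq> {0}" for L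
    using that least[of L] N
    by (intro fd.subspace_dim_equal left_ideal_subspace) (auto simp: C_def)
  obtain N' where N': "left_ideal UNIV N'" "N \<inter> N' = {0}" "UNIV = {x + y | x y. x \<in> N \<and> y \<in> N'}"
    using ss N(1) unfolding semisimple_def by blast
  obtain e e' where e: "e \<in> N" "e' \<in> N'" "1 = e + e'" using N'(3) by blast
  have ideal: "b * v \<in> N" if "v \<in> N" for b v using N(1) that by (simp add: left_ideal_def)
  \<comment> \<open>With \<open>1 = e + e'\<close>, the element \<open>v * e' = v - v * e\<close>
    lies in both complementary ideals and so vanishes.\<close>
  have right_unit: "v * e = v" if "v \<in> N" for v
  proof -
    have "v * e' = v - v * e" using e(3) by (metis add_diff_cancel_left' distrib_left mult_1_right)
    moreover have "v * e' \<in> N'" using N'(1) e(2) by (simp add: left_ideal_def)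
    moreover have "v - v * e \<in> N"
      using complex_vector.subspace_diff[OF left_ideal_subspace[OF N(1)]] that ideal e(1) by blast
    ultimately have "v - v * e \<in> N \<inter> N'" by simp
    then show ?thesis using N'(2) by simp
  qed
  obtain d h co where co: "coordinates N d h co"
    using coordinates_exist[OF S(1) S(2)[symmetric] left_ideal_subspace[OF N(1)]] by blast
  have irr: "irreducible_rep UNIV {..<d} (\<lambda>x i j. co (x * h j) i)"
    by (rule minimal_left_ideal_irreducible[OF N(1,3) co minimal])
  obtain l where l: "l \<in> L" "equivalent_reps UNIV {..<d} (\<lambda>x i j. co (x * h j) i) (I l) (\<rho> l)"
    using all[OF irr] by blast
  have "\<forall>i\<in>I l. \<forall>j\<in>I l. \<rho> l e i j = 0" using e(1) N(2) l(1) by (auto simp: J_def)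
  then have co0: "co (e * h j) i = 0" if "i < d" "j < d" for i j
    using equivalent_reps_vanish[OF l(2) _ _ left_regular_rep[OF N(1) co]] that by auto
  have comb: "(\<Sum>i<d. co v i *\<^sub>C h i) = v" if "v \<in> N" for v
    using co that by (simp add: coordinates_def)
  have "e * h j = 0" if "j < d" for j
  proof -
    have "h j \<in> N" using co that by (simp add: coordinates_def)
    from comb[OF ideal[OF this, of e]] show ?thesis using co0[OF _ that] by simp
  qed
  moreover have "e * e = (\<Sum>i<d. co e i *\<^sub>C (e * h i))"
  proof -
    have "e * e = e * (\<Sum>i<d. co e i *\<^sub>C h i)" using comb[OF e(1)] by simp
    then show ?thesis by (simp add: sum_distrib_left mult_scaleC_right)
  qed
  ultimately have "e * e = 0" by simp
  then have "e = 0" using right_unit[OF e(1)] by simp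
  then have "N \<subseteq> {0}" using right_unit by auto
  then show False using N by (auto simp: left_ideal_def)
qed

section \<open>The Birman--Murakami--Wenzl algebra and its Baxterized elements\<close>

lemma ring_inv_eqI:
  assumes "x * y = 1" "y * x = 1"
  shows "ring_inv x = y"
  unfolding ring_inv_def
proof (rule the_equality)
  show "x * y = 1 \<and> y * x = 1" using assms by simp
  fix z assume z: "x * z = 1 \<and> z * x = 1"
  have "z = z * (x * y)" using assms by simp
  also have "\<dots> = y" using z by (simp add: mult.assoc[symmetric])
  finally show "z = y" .
qed

lemma commute_prod_list:
  fixes z :: "'a::monoid_mult"
  assumes "\<And>x. x \<in> set xs \<Longrightarrow> z * x = x * z"
  shows "z * prod_list xs = prod_list xs * z"
  using assms
proof (induction xs)
  case (Cons x xs)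
  have "z * prod_list (x # xs) = x * (z * prod_list xs)"
    using Cons.prems[of x] by (simp add: mult.assoc[symmetric])
  then show ?case using Cons by (simp add: mult.assoc)
qed simp

lemma jucys_murphy_Suc:
  "1 \<le> k \<Longrightarrow> jucys_murphy T (Suc k) = T k * jucys_murphy T k * T k"
  by (simp add: jucys_murphy_def mult.assoc)

lemmas scaleC_simps =
  scaleC_add_right scaleC_add_left complex_vector.scale_right_diff_distrib
  complex_vector.scale_left_diff_distrib scaleC_scaleC mult_scaleC_left mult_scaleC_right

text \<open>The reflection equation for \<open>(c w x - 1) / (w - x)\<close>, projected to the eigenvalue \<open>s\<close> of \<open>x\<close>:
  here \<open>y = t x t\<close> plays the role of the next Jucys--Murphy element.\<close>

lemma reflection_identity:
  fixes e t x y k :: "'a::complex_algebra_1" and a a' b b' c l m s w \<nu> :: complex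
  assumes y: "y = t * x * t" and tt: "t * t = 1 + l *\<^sub>C t - (l * \<nu>) *\<^sub>C k"
    and tk: "t * k = \<nu> *\<^sub>C k" and xyk: "x * y * k = \<nu>\<^sup>2 *\<^sub>C k"
    and ex: "e * x = s *\<^sub>C e" and ey: "e * y = y * e" and "s \<noteq> 0" "\<nu> \<noteq> 0"
    and a: "a * (c * s * w - 1) = l" and a': "a' * (s - w) = l * w"
    and b: "b * (w - \<nu>\<^sup>2 / s) = - l * \<nu>\<^sup>2 / s"
    and b': "b' * (c * w * \<nu>\<^sup>2 / s - 1) = c * w * l * \<nu>\<^sup>2 / s"
  shows "e * (w *\<^sub>C 1 - y) * (t + a *\<^sub>C 1 + b *\<^sub>C k) * ((c * w) *\<^sub>C x - 1) =
    e * ((c * w) *\<^sub>C y - 1) * (t + a' *\<^sub>C 1 + b' *\<^sub>C k) * (w *\<^sub>C 1 - x)"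
proof -
  have yk: "y * k = \<nu> *\<^sub>C (t * x * k)"
    by (simp add: y tk mult.assoc mult_scaleC_right)
  have "y * t = t * x * (t * t)" by (simp add: y mult.assoc)
  also have "\<dots> = t * x + l *\<^sub>C y - l *\<^sub>C (y * k)"
    by (simp add: tt tk scaleC_simps algebra_simps y)
  finally have yt: "y * t = t * x + l *\<^sub>C y - l *\<^sub>C (y * k)" .
  have "s *\<^sub>C (e * y * k) = \<nu>\<^sup>2 *\<^sub>C (e * k)"
    using arg_cong[OF xyk, of "\<lambda>z. e * z"] ex
    by (simp add: mult.assoc[symmetric] mult_scaleC_left mult_scaleC_right)
  then have "inverse s *\<^sub>C (s *\<^sub>C (e * y * k)) = inverse s *\<^sub>C (\<nu>\<^sup>2 *\<^sub>C (e * k))" by simp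
  then have eyk: "e * y * k = (\<nu>\<^sup>2 / s) *\<^sub>C (e * k)"
    using \<open>s \<noteq> 0\<close> by (simp add: divide_inverse mult.commute scaleC_one)
  have eyx: "e * y * x = s *\<^sub>C (e * y)"
    using ey ex by (simp add: mult.assoc mult_scaleC_right)
  have eyt: "e * y * t = e * t * x + l *\<^sub>C (e * y) - (l * \<nu>\<^sup>2 / s) *\<^sub>C (e * k)"
  proof -
    have "e * y * t = e * t * x + l *\<^sub>C (e * y) - l *\<^sub>C (e * y * k)"
      by (simp add: mult.assoc yt distrib_left right_diff_distrib mult_scaleC_right)
    then show ?thesis by (simp add: eyk)
  qed
  \<comment> \<open>By \<open>eyk\<close>, the terms in \<open>e * k\<close> collect into one
    scalar, and the hypothesis \<open>b\<close> says that this scalar is 0; for \<open>R\<close> the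
    hypothesis \<open>b'\<close> does the same.\<close>
  have L: "e * (w *\<^sub>C 1 - y) * (t + a *\<^sub>C 1 + b *\<^sub>C k) =
      w *\<^sub>C (e * t) - e * t * x + (a * w) *\<^sub>C e - (l + a) *\<^sub>C (e * y)"
  proof -
    have "e * (w *\<^sub>C 1 - y) * (t + a *\<^sub>C 1 + b *\<^sub>C k) = w *\<^sub>C (e * t) - e * y * t +
        (a * w) *\<^sub>C e - a *\<^sub>C (e * y) + (b * w) *\<^sub>C (e * k) - b *\<^sub>C (e * y * k)"
      by (simp add: distrib_left distrib_right left_diff_distrib right_diff_distrib scaleC_simps mult.commute)
    also have "\<dots> = w *\<^sub>C (e * t) - e * t * x + (a * w) *\<^sub>C e - (l + a) *\<^sub>C (e * y)
        + (l * \<nu>\<^sup>2 / s + b * (w - \<nu>\<^sup>2 / s)) *\<^sub>C (e * k)"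
      by (simp add: eyt[unfolded mult.assoc] eyk[unfolded mult.assoc] scaleC_simps algebra_simps)
    finally show ?thesis by (simp add: b)
  qed
  have R: "e * ((c * w) *\<^sub>C y - 1) * (t + a' *\<^sub>C 1 + b' *\<^sub>C k) =
      (c * w) *\<^sub>C (e * t * x) - e * t + (c * w * (l + a')) *\<^sub>C (e * y) - a' *\<^sub>C e"
  proof -
    have "e * ((c * w) *\<^sub>C y - 1) * (t + a' *\<^sub>C 1 + b' *\<^sub>C k) = (c * w) *\<^sub>C (e * y * t) - e * t
        + (c * w * a') *\<^sub>C (e * y) - a' *\<^sub>C e + (c * w * b') *\<^sub>C (e * y * k) - b' *\<^sub>C (e * k)"
      by (simp add: distrib_left distrib_right left_diff_distrib right_diff_distrib scaleC_simps mult.commute)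
    also have "\<dots> = (c * w) *\<^sub>C (e * t * x) - e * t + (c * w * (l + a')) *\<^sub>C (e * y) - a' *\<^sub>C e
        + (b' * (c * w * \<nu>\<^sup>2 / s - 1) - c * w * l * \<nu>\<^sup>2 / s) *\<^sub>C (e * k)"
      by (simp add: eyt[unfolded mult.assoc] eyk[unfolded mult.assoc] scaleC_simps algebra_simps)
    finally show ?thesis by (simp add: b')
  qed
  have L': "(w *\<^sub>C (e * t) - e * t * x + (a * w) *\<^sub>C e - (l + a) *\<^sub>C (e * y)) * ((c * w) *\<^sub>C x - 1) =
      (c * w * w) *\<^sub>C (e * t * x) - w *\<^sub>C (e * t) - (c * w) *\<^sub>C (e * t * x * x) + e * t * x
      + (w * (a * (c * s * w - 1))) *\<^sub>C e - (l * (c * s * w - 1) + a * (c * s * w - 1)) *\<^sub>C (e * y)"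
    by (simp only: distrib_left distrib_right left_diff_distrib right_diff_distrib scaleC_simps
        ex eyx mult_1_right) (simp add: algebra_simps)
  have R': "((c * w) *\<^sub>C (e * t * x) - e * t + (c * w * (l + a')) *\<^sub>C (e * y) - a' *\<^sub>C e) * (w *\<^sub>C 1 - x) =
      (c * w * w) *\<^sub>C (e * t * x) - w *\<^sub>C (e * t) - (c * w) *\<^sub>C (e * t * x * x) + e * t * x
      + (a' * (s - w)) *\<^sub>C e - (c * w * (l * (s - w) + a' * (s - w))) *\<^sub>C (e * y)"
    by (simp only: distrib_left distrib_right left_diff_distrib right_diff_distrib scaleC_simps
        ex eyx mult_1_right) (simp add: algebra_simps)
  \<comment> \<open>Once \<open>a\<close> and \<open>a'\<close> are eliminated, only the
    coefficients of \<open>e\<close> and of \<open>e * y\<close> are left to compare. On both sides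
    they are \<open>l * w\<close> and \<open>- (l * c * s * w)\<close>.\<close>
  have "l * (c * s * w - 1) + l = c * w * (l * (s - w) + l * w)" "w * l = l * w"
    by (simp_all add: algebra_simps)
  then show ?thesis
    unfolding L R L' R' a a' by simp
qed

section \<open>Consequences of the relations and the inverse Baxterized elements\<close>

context bmw_relations
begin

abbreviation "l \<equiv> q - inverse q"
abbreviation "\<kappa> \<equiv> kappa q T"

lemma l_kappa: "l *\<^sub>C (1 - \<kappa> i) = T i - ring_inv (T i)"
  using q_generic by (simp add: kappa_def scaleC_one)

lemma Tinv_kappa:
  assumes "1 \<le> i" "i < n"
  shows "ring_inv (T i) * \<kappa> i = inverse \<nu> *\<^sub>C \<kappa> i"
proof -
  have "\<kappa> i = ring_inv (T i) * (T i * \<kappa> i)"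
    using T_inv_left[OF assms] by (simp add: mult.assoc[symmetric])
  also have "\<dots> = \<nu> *\<^sub>C (ring_inv (T i) * \<kappa> i)"
    using T_kappa[OF assms] by (simp add: mult_scaleC_right)
  finally have "inverse \<nu> *\<^sub>C \<kappa> i = inverse \<nu> *\<^sub>C (\<nu> *\<^sub>C (ring_inv (T i) * \<kappa> i))" by (rule arg_cong)
  then show ?thesis using nu_nonzero by (simp add: scaleC_one)
qed

lemma T_square:
  assumes "1 \<le> i" "i < n"
  shows "T i * T i = 1 + l *\<^sub>C T i - (l * \<nu>) *\<^sub>C \<kappa> i"
proof -
  have "T i * (l *\<^sub>C (1 - \<kappa> i)) = T i * T i - 1"
    unfolding l_kappa using T_inv_right[OF assms] by (simp add: right_diff_distrib)
  moreover have "T i * (l *\<^sub>C (1 - \<kappa> i)) = l *\<^sub>C T i - (l * \<nu>) *\<^sub>C \<kappa> i"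
    by (simp only: mult_scaleC_right right_diff_distrib mult_1_right T_kappa[OF assms]
        complex_vector.scale_right_diff_distrib scaleC_scaleC)
  ultimately have "T i * T i - 1 = l *\<^sub>C T i - (l * \<nu>) *\<^sub>C \<kappa> i" by simp
  then show ?thesis by (metis add_diff_eq diff_add_cancel add.commute)
qed

lemma kappa_square:
  assumes "1 \<le> i" "i < n"
  shows "\<kappa> i * \<kappa> i = (1 - (\<nu> - inverse \<nu>) / l) *\<^sub>C \<kappa> i"
proof -
  have "l *\<^sub>C ((1 - \<kappa> i) * \<kappa> i) = (T i - ring_inv (T i)) * \<kappa> i"
    unfolding l_kappa[symmetric] by (simp only: mult_scaleC_left)
  also have "\<dots> = (\<nu> - inverse \<nu>) *\<^sub>C \<kappa> i"
    using T_kappa[OF assms] Tinv_kappa[OF assms] by (simp add: left_diff_distrib scaleC_simps)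
  finally have "inverse l *\<^sub>C (l *\<^sub>C ((1 - \<kappa> i) * \<kappa> i)) = inverse l *\<^sub>C ((\<nu> - inverse \<nu>) *\<^sub>C \<kappa> i)"
    by (rule arg_cong)
  then have "(1 - \<kappa> i) * \<kappa> i = ((\<nu> - inverse \<nu>) / l) *\<^sub>C \<kappa> i"
    using q_generic by (simp add: scaleC_one divide_inverse mult.commute)
  then have "\<kappa> i - \<kappa> i * \<kappa> i = ((\<nu> - inverse \<nu>) / l) *\<^sub>C \<kappa> i"
    by (simp add: left_diff_distrib)
  then show ?thesis by (simp add: scaleC_simps scaleC_one algebra_simps)
qed

text \<open>An element that intertwines \<open>T i\<close> with \<open>T j\<close> also intertwines
  their inverses, and \<kappa> is a linear expression in 1, the generator and its inverse. The case
  \<open>i = j\<close> is commutation.\<close>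

lemma conj_kappa:
  assumes "1 \<le> i" "i < n" "1 \<le> j" "j < n" and z: "z * T i = T j * z"
  shows "z * \<kappa> i = \<kappa> j * z"
proof -
  have "z * ring_inv (T i) = ring_inv (T j) * (T j * z) * ring_inv (T i)"
    using T_inv_left[OF assms(3,4)] by (simp add: mult.assoc[symmetric])
  also have "\<dots> = ring_inv (T j) * z"
    using T_inv_right[OF assms(1,2)] by (simp add: z[symmetric] mult.assoc)
  finally show ?thesis
    using z by (simp add: kappa_def right_diff_distrib left_diff_distrib mult_scaleC_left mult_scaleC_right)
qed

text \<open>By the braid relation \<open>T i * T (Suc i)\<close> conjugates \<open>T i\<close> into
  \<open>T (Suc i)\<close>, hence \<open>\<kappa> i\<close> into \<open>\<kappa> (Suc i)\<close>.
  When the conjugated form is multiplied by \<open>\<kappa> i\<close>, the two inverse generators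
  contribute the scalars 1/\<nu> and \<nu>, which cancel. The second identity exchanges the roles of
  the two indices.\<close>

lemma TT_kappa:
  assumes "1 \<le> i" "Suc i < n"
  shows "T i * T (Suc i) * \<kappa> i = \<kappa> (Suc i) * \<kappa> i"
    and "T (Suc i) * T i * \<kappa> (Suc i) = \<kappa> i * \<kappa> (Suc i)"
proof -
  have i: "1 \<le> i" "i < n" "1 \<le> Suc i" "Suc i < n" using assms by simp_all
  have inv: "T i * ring_inv (T i) = 1" "T (Suc i) * ring_inv (T (Suc i)) = 1"
    using T_inv_right i by blast+
  have unit: "z = z * T i * ring_inv (T i)" "z = z * T (Suc i) * ring_inv (T (Suc i))" for z
    using inv by (simp_all add: mult.assoc)
  have "T i * T (Suc i) * \<kappa> i = \<kappa> (Suc i) * (T i * T (Suc i))"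
    by (rule conj_kappa[OF i]) (simp add: braid[OF assms] mult.assoc[symmetric])
  then have "\<kappa> (Suc i) = T i * T (Suc i) * \<kappa> i * ring_inv (T (Suc i)) * ring_inv (T i)"
    using unit by (simp add: mult.assoc[symmetric])
  then have "\<kappa> (Suc i) * \<kappa> i =
      T i * T (Suc i) * \<kappa> i * ring_inv (T (Suc i)) * (ring_inv (T i) * \<kappa> i)"
    by (simp add: mult.assoc)
  also have "\<dots> = inverse \<nu> *\<^sub>C (T i * T (Suc i) * (\<kappa> i * ring_inv (T (Suc i)) * \<kappa> i))"
    using Tinv_kappa i by (simp add: mult_scaleC_right mult.assoc)
  also have "\<dots> = T i * T (Suc i) * \<kappa> i"
    using kappa_Tinv_next_kappa[OF assms] nu_nonzero by (simp add: mult_scaleC_right scaleC_one)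
  finally show "T i * T (Suc i) * \<kappa> i = \<kappa> (Suc i) * \<kappa> i" by simp
  have "T (Suc i) * T i * \<kappa> (Suc i) = \<kappa> i * (T (Suc i) * T i)"
    by (rule conj_kappa[OF i(3,4,1,2)]) (simp add: braid[OF assms] mult.assoc[symmetric])
  then have "\<kappa> i = T (Suc i) * T i * \<kappa> (Suc i) * ring_inv (T i) * ring_inv (T (Suc i))"
    using unit by (simp add: mult.assoc[symmetric])
  then have "\<kappa> i * \<kappa> (Suc i) =
      T (Suc i) * T i * \<kappa> (Suc i) * ring_inv (T i) * (ring_inv (T (Suc i)) * \<kappa> (Suc i))"
    by (simp add: mult.assoc)
  also have "\<dots> = inverse \<nu> *\<^sub>C (T (Suc i) * T i * (\<kappa> (Suc i) * ring_inv (T i) * \<kappa> (Suc i)))"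
    using Tinv_kappa i by (simp add: mult_scaleC_right mult.assoc)
  also have "\<dots> = T (Suc i) * T i * \<kappa> (Suc i)"
    using kappa_Tinv_prev_kappa[OF assms] nu_nonzero by (simp add: mult_scaleC_right scaleC_one)
  finally show "T (Suc i) * T i * \<kappa> (Suc i) = \<kappa> i * \<kappa> (Suc i)" by simp
qed

text \<open>Sandwiching \<open>l *\<^sub>C (1 - \<kappa> i) = T i - ring_inv (T i)\<close> between
  two copies of \<open>\<kappa> (Suc i)\<close> gives a multiple of \<open>\<kappa> (Suc i)\<close>
  whose scalar is cancelled by the one in \<open>kappa_square\<close>.\<close>

lemma kappa_kappa_kappa:
  assumes "1 \<le> i" "Suc i < n"
  shows "\<kappa> (Suc i) * \<kappa> i * \<kappa> (Suc i) = \<kappa> (Suc i)"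
proof -
  let ?k = "\<kappa> (Suc i)" and ?d = "\<nu> - inverse \<nu>"
  have i: "1 \<le> Suc i" "Suc i < n" using assms by simp_all
  have "l *\<^sub>C (?k * (1 - \<kappa> i) * ?k) = ?k * (T i - ring_inv (T i)) * ?k"
    unfolding l_kappa[symmetric] by (simp only: mult_scaleC_left mult_scaleC_right)
  also have "\<dots> = (- ?d) *\<^sub>C ?k"
    using kappa_T_prev_kappa[OF assms] kappa_Tinv_prev_kappa[OF assms]
    by (simp add: left_diff_distrib right_diff_distrib scaleC_simps del: complex_vector.scale_minus_left)
  finally have "inverse l *\<^sub>C (l *\<^sub>C (?k * (1 - \<kappa> i) * ?k)) = inverse l *\<^sub>C ((- ?d) *\<^sub>C ?k)"
    by (rule arg_cong)
  then have "?k * (1 - \<kappa> i) * ?k = (- ?d / l) *\<^sub>C ?k"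
    using q_generic by (simp add: scaleC_one divide_inverse mult.commute)
  then have "?k * ?k - ?k * \<kappa> i * ?k = (- ?d / l) *\<^sub>C ?k"
    by (simp add: left_diff_distrib right_diff_distrib)
  then have "?k * \<kappa> i * ?k = ?k * ?k - (- ?d / l) *\<^sub>C ?k" by (simp add: algebra_simps)
  also have "\<dots> = (1 - ?d / l - - ?d / l) *\<^sub>C ?k"
    unfolding kappa_square[OF i] complex_vector.scale_left_diff_distrib ..
  also have "1 - ?d / l - - ?d / l = 1"
    by (simp only: minus_divide_left[symmetric] diff_minus_eq_add diff_add_cancel)
  finally show ?thesis by (simp only: scaleC_one)
qed

lemma T_jucys_murphy_commute:
  assumes "j < k" "k < n"
  shows "T k * jucys_murphy T j = jucys_murphy T j * T k"
proof -
  have com: "T k * x = x * T k" if x: "x \<in> T ` {1..<j}" for x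
  proof -
    obtain i where i: "x = T i" "1 \<le> i" "i < j" using x by auto
    then show ?thesis using far_commute[of i k] assms by simp
  qed
  show ?thesis
    unfolding jucys_murphy_def mult.assoc[symmetric]
    by (subst commute_prod_list, use com in force)
      (simp only: mult.assoc, subst commute_prod_list, use com in force, rule refl)
qed

text \<open>Two braid moves give y_{k+1} y_{k+2} = T_k T_{k+1} (y_k y_{k+1}) T_{k+1} T_k. Applied to
  \<kappa>_{k+1}, the right-hand pair becomes \<kappa>_k \<kappa>_{k+1}, so the induction hypothesis
  acts on \<kappa>_k; the left-hand pair then yields \<kappa>_{k+1} \<kappa>_k \<kappa>_{k+1} =
  \<kappa>_{k+1}.\<close>

lemma jucys_murphy_kappa:
  "1 \<le> k \<Longrightarrow> k < n \<Longrightarrow>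
    jucys_murphy T k * jucys_murphy T (Suc k) * \<kappa> k = \<nu>\<^sup>2 *\<^sub>C \<kappa> k"
proof (induction k rule: nat_induct_at_least)
  case base
  have "jucys_murphy T 1 = 1" by (simp add: jucys_murphy_def)
  then have "jucys_murphy T 1 * jucys_murphy T (Suc 1) * \<kappa> 1 = T 1 * (T 1 * \<kappa> 1)"
    by (simp add: jucys_murphy_Suc mult.assoc)
  then show ?case
    using T_kappa[of 1] base by (simp add: mult_scaleC_right power2_eq_square)
next
  case (Suc k)
  let ?y = "jucys_murphy T k" and ?a = "T k" and ?b = "T (Suc k)" and ?k = "\<kappa> (Suc k)"
  have k: "1 \<le> k" "Suc k < n" using Suc by simp_all
  have yb: "?b * ?y = ?y * ?b" using T_jucys_murphy_commute[of k "Suc k"] k by simp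
  have yb': "?b * (?y * z) = ?y * (?b * z)" for z
    using yb by (simp add: mult.assoc[symmetric])
  have "jucys_murphy T (Suc k) * jucys_murphy T (Suc (Suc k)) =
      ?a * ?y * (?a * ?b * ?a) * ?y * ?a * ?b"
    using k by (simp add: jucys_murphy_Suc mult.assoc)
  also have "\<dots> = ?a * (?y * ?b) * ?a * (?b * ?y) * ?a * ?b"
    by (simp only: braid[OF k]) (simp only: mult.assoc)
  also have "\<dots> = ?a * ?b * ?y * ?a * ?y * (?b * ?a * ?b)"
    by (simp only: mult.assoc yb yb')
  also have "\<dots> = ?a * ?b * (?y * ?a * ?y * ?a) * (?b * ?a)"
    by (simp only: braid[OF k, symmetric]) (simp only: mult.assoc)
  also have "\<dots> = ?a * ?b * (?y * jucys_murphy T (Suc k)) * (?b * ?a)"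
    using k by (simp add: jucys_murphy_Suc mult.assoc)
  finally have "jucys_murphy T (Suc k) * jucys_murphy T (Suc (Suc k)) * ?k =
      ?a * ?b * (?y * jucys_murphy T (Suc k)) * (?b * ?a * ?k)"
    by (simp add: mult.assoc)
  also have "\<dots> = ?a * ?b * (?y * jucys_murphy T (Suc k) * \<kappa> k) * ?k"
    using TT_kappa(2)[OF k] by (simp add: mult.assoc)
  also have "\<dots> = \<nu>\<^sup>2 *\<^sub>C (?a * ?b * \<kappa> k * ?k)"
    using Suc by (simp add: mult_scaleC_left mult_scaleC_right)
  also have "\<dots> = \<nu>\<^sup>2 *\<^sub>C ?k"
    using TT_kappa(1)[OF k] kappa_kappa_kappa[OF k] by simp
  finally show ?case .
qed

text \<open>The bracket is the Baxterized element with its two spectral arguments exchanged, with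
  nested quotients cleared so that it is visibly rational in \<open>w\<close> and
  \<open>x\<close>.\<close>

definition baxter_T_inverse :: "nat \<Rightarrow> complex \<Rightarrow> complex \<Rightarrow> 'a"
  where "baxter_T_inverse i w x =
    ((w - x)\<^sup>2 / ((w - q\<^sup>2 * x) * (w - inverse q ^ 2 * x))) *\<^sub>C
      (T i + (l * x / (w - x)) *\<^sub>C 1 + (l * x / (x + inverse \<nu> * q * w)) *\<^sub>C \<kappa> i)"

text \<open>The span of 1, \<open>T i\<close> and \<open>\<kappa> i\<close> is closed under
  multiplication, so the claim is three scalar identities: the coefficients of \<open>T i\<close>
  and \<open>\<kappa> i\<close> vanish, and the coefficient of 1 is the stated quotient.\<close>

lemma baxter_T_mult:
  assumes i: "1 \<le> i" "i < n" and "w \<noteq> x" "x + inverse \<nu> * q * w \<noteq> 0" "w + inverse \<nu> * q * x \<noteq> 0"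
  shows "(T i + (l * x / (w - x)) *\<^sub>C 1 + (l * x / (x + inverse \<nu> * q * w)) *\<^sub>C \<kappa> i) *
      (T i + (l * w / (x - w)) *\<^sub>C 1 + (l * w / (w + inverse \<nu> * q * x)) *\<^sub>C \<kappa> i) =
    ((w - q\<^sup>2 * x) * (w - inverse q ^ 2 * x) / (w - x)\<^sup>2) *\<^sub>C 1"
proof -
  have gen: "(T i + a *\<^sub>C 1 + b *\<^sub>C \<kappa> i) * (T i + a' *\<^sub>C 1 + b' *\<^sub>C \<kappa> i) =
      (l + a + a') *\<^sub>C T i + (1 + a * a') *\<^sub>C 1 +
      (- l * \<nu> + \<nu> * b + \<nu> * b' + a * b' + b * a' + b * b' * (1 - (\<nu> - inverse \<nu>) / l)) *\<^sub>C \<kappa> i"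
    for a b a' b'
    by (simp only: distrib_left distrib_right scaleC_simps mult_1_left mult_1_right
        T_square[OF i] T_kappa[OF i] kappa_T[OF i] kappa_square[OF i]) (simp add: scaleC_one algebra_simps)
  have "w - x \<noteq> 0" "x - w \<noteq> 0" using assms(3) by auto
  have "a + a * x / (w - x) + a * w / (x - w) = 0" for a
    using \<open>w - x \<noteq> 0\<close> \<open>x - w \<noteq> 0\<close> by (simp add: divide_simps) (simp add: algebra_simps)
  then have 1: "l + l * x / (w - x) + l * w / (x - w) = 0" .
  have "1 + l * x / (w - x) * (l * w / (x - w)) = ((w - x)\<^sup>2 - l\<^sup>2 * x * w) / (w - x)\<^sup>2"
    using \<open>w - x \<noteq> 0\<close> \<open>x - w \<noteq> 0\<close> by (simp add: divide_simps) (simp add: power2_eq_square algebra_simps)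
  moreover have "(w - x)\<^sup>2 - l\<^sup>2 * x * w = (w - q\<^sup>2 * x) * (w - inverse q ^ 2 * x)"
    using q_nonzero by (simp add: field_simps power2_eq_square)
  ultimately have 2: "1 + l * x / (w - x) * (l * w / (x - w)) =
      (w - q\<^sup>2 * x) * (w - inverse q ^ 2 * x) / (w - x)\<^sup>2"
    by simp
  define r where "r = inverse \<nu> * q"
  define A where "A = x + r * w"
  define B where "B = w + r * x"
  have AB: "A \<noteq> 0" "B \<noteq> 0" using assms(4,5) by (simp_all add: A_def B_def r_def)
  have "l * x / (w - x) * (l * w / B) + l * x / A * (l * w / (x - w)) =
      l * (l * x * w) * ((A - B) / (w - x)) / (A * B)"
    using AB \<open>w - x \<noteq> 0\<close> \<open>x - w \<noteq> 0\<close> by (simp add: divide_simps) (simp add: algebra_simps)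
  moreover have "(A - B) / (w - x) = r - 1"
    using \<open>w - x \<noteq> 0\<close> by (simp add: divide_simps A_def B_def algebra_simps)
  moreover have "l * x / A * (l * w / B) * (1 - (\<nu> - inverse \<nu>) / l) =
      l * (x * w * (l - (\<nu> - inverse \<nu>))) / (A * B)"
    using q_generic AB by (simp add: divide_simps)
  moreover have "- l * \<nu> + \<nu> * (l * x / A) + \<nu> * (l * w / B) = l * (\<nu> * x * w * (1 - r\<^sup>2)) / (A * B)"
  proof -
    have "- (A * B) + x * B + w * A = x * w * (1 - r\<^sup>2)"
      by (simp add: A_def B_def algebra_simps power2_eq_square)
    moreover have "- l * \<nu> + \<nu> * (l * x / A) + \<nu> * (l * w / B) =
        l * \<nu> * (- (A * B) + x * B + w * A) / (A * B)"
      using AB by (simp add: divide_simps) (simp add: algebra_simps)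
    ultimately show ?thesis by simp
  qed
  ultimately have "- l * \<nu> + \<nu> * (l * x / A) + \<nu> * (l * w / B)
      + l * x / (w - x) * (l * w / B) + l * x / A * (l * w / (x - w))
      + l * x / A * (l * w / B) * (1 - (\<nu> - inverse \<nu>) / l) =
      l * (x * w) * (\<nu> * (1 - r\<^sup>2) + l * (r - 1) + (l - (\<nu> - inverse \<nu>))) / (A * B)"
    by (simp only: add.assoc) (simp add: add_divide_distrib[symmetric] algebra_simps)
  \<comment> \<open>The origin of the constant q/\<nu> in the Baxterized elements: the
    \<kappa>-coefficient vanishes because r = q/\<nu> is a root of \<nu> r^2 - l r -
    1/\<nu>.\<close>
  moreover have "\<nu> * (1 - r\<^sup>2) + l * (r - 1) + (l - (\<nu> - inverse \<nu>)) = 0"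
    using q_nonzero nu_nonzero by (simp add: r_def field_simps power2_eq_square)
  ultimately have 3: "- l * \<nu> + \<nu> * (l * x / (x + inverse \<nu> * q * w)) + \<nu> * (l * w / (w + inverse \<nu> * q * x))
      + l * x / (w - x) * (l * w / (w + inverse \<nu> * q * x))
      + l * x / (x + inverse \<nu> * q * w) * (l * w / (x - w))
      + l * x / (x + inverse \<nu> * q * w) * (l * w / (w + inverse \<nu> * q * x)) *
        (1 - (\<nu> - inverse \<nu>) / l) = 0"
    by (simp add: A_def B_def r_def)
  show ?thesis unfolding gen 1 2 3 by simp
qed

lemma ring_inv_baxter_T:
  assumes i: "1 \<le> i" "i < n" and "w \<noteq> 0" "w \<noteq> x"
    and "x + inverse \<nu> * q * w \<noteq> 0" "w + inverse \<nu> * q * x \<noteq> 0"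
    and "w - q\<^sup>2 * x \<noteq> 0" "w - inverse q ^ 2 * x \<noteq> 0"
  shows "ring_inv (baxter_T q \<nu> T i w x) = baxter_T_inverse i w x"
    and "baxter_T_inverse i w x * baxter_T q \<nu> T i w x = 1"
    and "baxter_T q \<nu> T i w x * baxter_T_inverse i w x = 1"
proof -
  have eq: "baxter_T q \<nu> T i w x =
      T i + (l * w / (x - w)) *\<^sub>C 1 + (l * w / (w + inverse \<nu> * q * x)) *\<^sub>C \<kappa> i"
  proof -
    have "l / (x / w - 1) = l * w / (x - w)"
      using \<open>w \<noteq> 0\<close> \<open>w \<noteq> x\<close> by (simp add: divide_simps)
    moreover have "l / (1 + inverse \<nu> * q * (x / w)) = l * w / (w + inverse \<nu> * q * x)"
    proof -
      have "1 + inverse \<nu> * q * (x / w) = (w + inverse \<nu> * q * x) / w"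
        using \<open>w \<noteq> 0\<close> by (simp add: add_divide_distrib)
      then show ?thesis by simp
    qed
    ultimately show ?thesis by (simp only: baxter_T_def)
  qed
  have nz: "(w - q\<^sup>2 * x) * (w - inverse q ^ 2 * x) \<noteq> 0" "(w - x)\<^sup>2 \<noteq> 0"
    using assms by simp_all
  have cancel: "r *\<^sub>C (r' *\<^sub>C 1) = (1 :: 'a)" if "r * r' = 1" for r r'
    using that by (simp add: scaleC_one)
  show 1: "baxter_T_inverse i w x * baxter_T q \<nu> T i w x = 1"
    unfolding baxter_T_inverse_def eq mult_scaleC_left baxter_T_mult[OF i assms(4-6)]
    by (rule cancel) (use nz in simp)
  \<comment> \<open>The product in the other order is the same lemma with \<open>w\<close> and
    \<open>x\<close> exchanged, so the scalar has to be symmetric in them.\<close>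
  have sym: "(x - q\<^sup>2 * w) * (x - inverse q ^ 2 * w) / (x - w)\<^sup>2 =
      (w - q\<^sup>2 * x) * (w - inverse q ^ 2 * x) / (w - x)\<^sup>2"
  proof -
    have "(x - q\<^sup>2 * w) * (x - inverse q ^ 2 * w) = (w - q\<^sup>2 * x) * (w - inverse q ^ 2 * x)"
      using q_nonzero by (simp add: field_simps power2_eq_square)
    then show ?thesis by (simp add: power2_commute)
  qed
  show 2: "baxter_T q \<nu> T i w x * baxter_T_inverse i w x = 1"
    unfolding baxter_T_inverse_def eq mult_scaleC_right
      baxter_T_mult[OF i assms(4)[symmetric] assms(6,5)] sym
    by (rule cancel) (use nz in simp)
  show "ring_inv (baxter_T q \<nu> T i w x) = baxter_T_inverse i w x"
    using 1 2 by (rule ring_inv_eqI[rotated])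
qed

end

section \<open>Consecutive evaluation\<close>

text \<open>An expression that is affine in \<open>u j\<close> with nonzero leading coefficient can
  be solved for \<open>u j\<close>; the witness gives it the value 1. The denominators of the
  inverse Baxterized elements have this form.\<close>

lemma affine_nonzero:
  fixes x :: "(nat \<Rightarrow> complex) \<Rightarrow> complex"
  assumes "\<And>u t. x (u(j := t)) = x u" "\<alpha> \<noteq> (0::complex)"
  shows "\<exists>u. \<alpha> * u j + \<beta> * x u \<noteq> 0"
proof -
  define v :: "nat \<Rightarrow> complex" where "v = (\<lambda>_. 0)"
  have "\<alpha> * ((1 - \<beta> * x v) / \<alpha>) + \<beta> * x v = 1" using assms(2) by simp
  then show ?thesis
    using assms(1)[of v] by (intro exI[of _ "v(j := (1 - \<beta> * x v) / \<alpha>)"]) simp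
qed

lemma generically_affine:
  assumes "poly_fun n x" "j \<in> {1..n}" "\<And>u t. x (u(j := t)) = x u" "\<alpha> \<noteq> (0::complex)"
  shows "generically n (\<lambda>u. \<alpha> * u j + \<beta> * x u \<noteq> 0)"
proof -
  obtain u where "\<alpha> * u j + \<beta> * x u \<noteq> 0" using affine_nonzero[OF assms(3,4)] by blast
  then show ?thesis
    using assms(1,2) by (intro generically_nonzero[where u = u]) (intro poly_fun_intros)
qed

text \<open>Fixing \<open>u k\<close> leaves the denominator affine in the free variable
  \<open>u j\<close>, so it cannot vanish identically on the hyperplane, whatever the value
  \<open>a\<close> is.\<close>

lemma evaluates_to_divide_affine:
  assumes x: "poly_fun n x" "poly_fun n r" and j: "j \<in> {1..n}" "j \<noteq> k"
    and indep: "\<And>u t. x (u(j := t)) = x u" and "\<alpha> \<noteq> (0::complex)"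
  shows "evaluates_to n k a (\<lambda>u. r u / (\<alpha> * u j + \<beta> * x u))
    (\<lambda>u. r (u(k := a)) / (\<alpha> * u j + \<beta> * x (u(k := a))))"
proof -
  have "x (u(k := a, j := t)) = x (u(k := a))" for u t using indep by simp
  then have "x (u(j := t, k := a)) = x (u(k := a))" for u t
    using j(2) by (simp add: fun_upd_twist)
  then obtain u where "\<alpha> * u j + \<beta> * x (u(k := a)) \<noteq> 0"
    using affine_nonzero[of "\<lambda>u. x (u(k := a))" j \<alpha> \<beta>] assms(6) by blast
  then have "\<alpha> * (u(k := a)) j + \<beta> * x (u(k := a)) \<noteq> 0" using j(2) by simp
  moreover have "poly_fun n (\<lambda>u. \<alpha> * u j + \<beta> * x u)"
    using x(1) j(1) by (intro poly_fun_intros)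
  ultimately show ?thesis
    using evaluates_to_divide[OF x(2), of "\<lambda>u. \<alpha> * u j + \<beta> * x u" u k a] j(2) by simp
qed

text \<open>At \<open>u j = 0\<close> the two denominators are -1 and 1, independently of
  \<open>x\<close> and \<open>a\<close>; hence the origin serves as witness.\<close>

lemma evaluates_to_baxter_Q:
  assumes x: "poly_fun n x" and j: "j \<in> {1..n}" "j \<noteq> k"
  shows "evaluates_to n k a (\<lambda>u. baxter_Q q \<nu> T m (x u) (u j) c)
    (\<lambda>u. baxter_Q q \<nu> T m (x (u(k := a))) (u j) c)"
proof -
  have 1: "evaluates_to n k a (\<lambda>u. (q - inverse q) / (c * x u * u j - 1))
      (\<lambda>u. (q - inverse q) / (c * x (u(k := a)) * (u(k := a)) j - 1))"
    using x j by (intro evaluates_to_divide[where u = "\<lambda>_. 0"] poly_fun_intros) auto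
  have 2: "evaluates_to n k a (\<lambda>u. (q - inverse q) / (1 + inverse \<nu> * q * c * x u * u j))
      (\<lambda>u. (q - inverse q) / (1 + inverse \<nu> * q * c * x (u(k := a)) * (u(k := a)) j))"
    using x j by (intro evaluates_to_divide[where u = "\<lambda>_. 0"] poly_fun_intros) auto
  have upd: "(u(k := a)) j = u j" for u :: "nat \<Rightarrow> complex" using j by simp
  show ?thesis
    unfolding baxter_Q_def
    by (intro evaluates_to_add evaluates_to_const evaluates_to_scaleC 1[unfolded upd] 2[unfolded upd])
qed

context bmw_relations
begin

text \<open>The pointwise inverse agrees generically with the explicit formula
  \<open>baxter_T_inverse\<close>, both before and after \<open>u k\<close> is fixed. The formula is
  built from fractions with denominators affine in \<open>u j\<close>, so the evaluation rules apply
  to it.\<close>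

lemma evaluates_to_ring_inv_baxter_T:
  assumes x: "poly_fun n x" and j: "j \<in> {1..n}" "j \<noteq> k"
    and indep: "\<And>u t. x (u(j := t)) = x u" and m: "1 \<le> m" "m < n"
  shows "evaluates_to n k a (\<lambda>u. ring_inv (baxter_T q \<nu> T m (u j) (x u)))
    (\<lambda>u. ring_inv (baxter_T q \<nu> T m (u j) (x (u(k := a)))))"
proof -
  have gen: "generically n (\<lambda>u. ring_inv (baxter_T q \<nu> T m (u j) (z u)) = baxter_T_inverse m (u j) (z u))"
    if z: "poly_fun n z" "\<And>u t. z (u(j := t)) = z u" for z
  proof -
    note aff = generically_affine[OF z(1) j(1) z(2)]
    have g: "inverse \<nu> * q \<noteq> 0" using q_nonzero nu_nonzero by simp
    show ?thesis
      by (rule generically_mono[OF generically_conj[OF aff[of 1 0] generically_conj[OF aff[of 1 "-1"]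
            generically_conj[OF aff[OF g, of 1] generically_conj[OF aff[of 1 "inverse \<nu> * q"]
            generically_conj[OF aff[of 1 "- q\<^sup>2"] aff[of 1 "- (inverse q ^ 2)"]]]]]]])
        (auto intro!: ring_inv_baxter_T(1)[OF m] simp: add.commute)
  qed
  have upd: "x (u(j := t, k := a)) = x (u(k := a))" for u t
    using indep[of "u(k := a)" t] j(2) by (simp add: fun_upd_twist)
  note ev = evaluates_to_divide_affine[OF x _ j indep, of _ _ a]
  have 1: "evaluates_to n k a (\<lambda>u. (u j - x u) / (1 * u j + (- d) * x u))
      (\<lambda>u. (u j - x (u(k := a))) / (1 * u j + (- d) * x (u(k := a))))" for d
    using ev[of "\<lambda>u. u j - x u" 1 "- d"] x j by (simp add: poly_fun_intros fun_upd_def)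
  have 2: "evaluates_to n k a (\<lambda>u. (l * x u) / (1 * u j + (- 1) * x u))
      (\<lambda>u. (l * x (u(k := a))) / (1 * u j + (- 1) * x (u(k := a))))"
    using ev[of "\<lambda>u. l * x u" 1 "- 1"] x by (simp add: poly_fun_intros fun_upd_def)
  have 3: "evaluates_to n k a (\<lambda>u. (l * x u) / ((inverse \<nu> * q) * u j + 1 * x u))
      (\<lambda>u. (l * x (u(k := a))) / ((inverse \<nu> * q) * u j + 1 * x (u(k := a))))"
    using ev[of "\<lambda>u. l * x u" "inverse \<nu> * q" 1] x q_nonzero nu_nonzero
    by (simp add: poly_fun_intros fun_upd_def)
  \<comment> \<open>The redundant factors 1 display each denominator as \<alpha> \<open>u j\<close>
    + \<beta> \<open>x u\<close>, the shape of the affine rule; the squared numerator is split over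
    two fractions.\<close>
  have form: "baxter_T_inverse m w z =
      ((w - z) / (1 * w + (- (q\<^sup>2)) * z) * ((w - z) / (1 * w + (- (inverse q ^ 2)) * z))) *\<^sub>C
        (T m + ((l * z) / (1 * w + (- 1) * z)) *\<^sub>C 1 + ((l * z) / ((inverse \<nu> * q) * w + 1 * z)) *\<^sub>C \<kappa> m)"
    for w z
    by (simp add: baxter_T_inverse_def power2_eq_square[of "w - z"] add.commute)
  have "evaluates_to n k a (\<lambda>u. baxter_T_inverse m (u j) (x u))
      (\<lambda>u. baxter_T_inverse m (u j) (x (u(k := a))))"
    unfolding form
    by (intro evaluates_to_add evaluates_to_const evaluates_to_scaleC evaluates_to_mult 1 2 3)
  then show ?thesis
    by (rule evaluates_to_cong)
      (intro gen[OF x indep] gen[OF poly_fun_upd[OF x] upd])+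
qed

end

text \<open>\<open>p j a\<close> is the spectral projection of the \<open>j\<close>-th Jucys--Murphy element for the eigenvalue
  \<open>a\<close>; the finite set \<open>S j\<close> contains its spectrum.\<close>

locale jucys_murphy_spectrum = bmw_relations n q \<nu> T
  for n q \<nu> and T :: "nat \<Rightarrow> 'a::complex_algebra_1" +
  fixes s :: "nat \<Rightarrow> complex" and S :: "nat \<Rightarrow> complex set" and p :: "nat \<Rightarrow> complex \<Rightarrow> 'a"
  assumes finite_S: "finite (S j)" and s_in_S: "s j \<in> S j"
    and s_nonzero: "1 \<le> j \<Longrightarrow> j \<le> n \<Longrightarrow> s j \<noteq> 0"
    and s_generic: "1 \<le> j \<Longrightarrow> j \<le> n \<Longrightarrow> c_param q \<nu> * (s j)\<^sup>2 \<noteq> 1"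
    and jm_commute: "1 \<le> i \<Longrightarrow> i \<le> n \<Longrightarrow> 1 \<le> j \<Longrightarrow> j \<le> n \<Longrightarrow>
      jucys_murphy T i * jucys_murphy T j = jucys_murphy T j * jucys_murphy T i"
    and p_sum: "1 \<le> j \<Longrightarrow> j \<le> n \<Longrightarrow> (\<Sum>a\<in>S j. p j a) = 1"
    and jm_p: "1 \<le> j \<Longrightarrow> j \<le> n \<Longrightarrow> a \<in> S j \<Longrightarrow> jucys_murphy T j * p j a = a *\<^sub>C p j a"
    and p_commute: "z * jucys_murphy T j = jucys_murphy T j * z \<Longrightarrow> z * p j a = p j a * z"
begin

abbreviation "y \<equiv> jucys_murphy T"
abbreviation "c \<equiv> c_param q \<nu>"

definition resolvent :: "nat \<Rightarrow> complex \<Rightarrow> 'a"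
  where "resolvent j w = (\<Sum>a\<in>S j. inverse (w - a) *\<^sub>C p j a)"

definition partial_idem :: "nat \<Rightarrow> 'a"
  where "partial_idem k = prod_list (map (\<lambda>j. p j (s j)) [1..<Suc k])"

lemma partial_idem_0: "partial_idem 0 = 1"
  by (simp add: partial_idem_def)

lemma partial_idem_Suc: "partial_idem (Suc k) = partial_idem k * p (Suc k) (s (Suc k))"
  by (simp add: partial_idem_def)

lemma partial_idem_commute:
  "(\<And>j. 1 \<le> j \<Longrightarrow> j \<le> k \<Longrightarrow> z * y j = y j * z) \<Longrightarrow> z * partial_idem k = partial_idem k * z"
  unfolding partial_idem_def by (rule commute_prod_list) (auto intro!: p_commute)

lemma partial_idem_jm:
  assumes "1 \<le> k" "k \<le> n"
  shows "partial_idem k * y k = s k *\<^sub>C partial_idem k"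
proof -
  obtain i where i: "k = Suc i" using assms by (cases k) auto
  have "partial_idem k * y k = partial_idem i * (p k (s k) * y k)"
    by (simp add: i partial_idem_Suc mult.assoc)
  also have "p k (s k) * y k = y k * p k (s k)" by (rule p_commute[symmetric]) simp
  finally show ?thesis
    using jm_p[OF assms s_in_S] by (simp add: i partial_idem_Suc mult_scaleC_right)
qed

lemma resolvent_inverse:
  assumes "1 \<le> j" "j \<le> n" "w \<notin> S j"
  shows "(w *\<^sub>C 1 - y j) * resolvent j w = 1" "resolvent j w * (w *\<^sub>C 1 - y j) = 1"
proof -
  have "(w *\<^sub>C 1 - y j) * (inverse (w - a) *\<^sub>C p j a) = p j a" if "a \<in> S j" for a
  proof -
    have "w - a \<noteq> 0" using that assms(3) by auto
    have "(w *\<^sub>C 1 - y j) * p j a = (w - a) *\<^sub>C p j a"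
      using jm_p[OF assms(1,2) that]
      by (simp add: left_diff_distrib mult_scaleC_left complex_vector.scale_left_diff_distrib)
    then show ?thesis using \<open>w - a \<noteq> 0\<close> by (simp add: mult_scaleC_right scaleC_one)
  qed
  then show 1: "(w *\<^sub>C 1 - y j) * resolvent j w = 1"
    using p_sum[OF assms(1,2)] by (simp add: resolvent_def sum_distrib_left)
  have "(w *\<^sub>C 1 - y j) * resolvent j w = resolvent j w * (w *\<^sub>C 1 - y j)"
    unfolding resolvent_def sum_distrib_left sum_distrib_right mult_scaleC_left mult_scaleC_right
    by (intro sum.cong refl arg_cong2[where f = scaleC] p_commute)
      (simp add: left_diff_distrib right_diff_distrib mult_scaleC_left mult_scaleC_right)
  then show "resolvent j w * (w *\<^sub>C 1 - y j) = 1" using 1 by simp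
qed

text \<open>Excludes the points where \<open>w - y j\<close> may fail to be invertible or where a
  Baxterized factor with one parameter at \<open>s j\<close> degenerates. All indices are treated at
  once because the induction on \<open>k\<close> keeps a single \<open>w\<close>.\<close>

definition good :: "complex \<Rightarrow> bool"
  where "good w \<longleftrightarrow> w \<noteq> 0 \<and> w \<noteq> 1 \<and> (\<forall>j\<in>{1..n}. w \<notin> S j \<and>
    s j + inverse \<nu> * q * w \<noteq> 0 \<and> w + inverse \<nu> * q * s j \<noteq> 0 \<and>
    w - q\<^sup>2 * s j \<noteq> 0 \<and> w - inverse q ^ 2 * s j \<noteq> 0 \<and>
    c * s j * w - 1 \<noteq> 0 \<and> 1 + inverse \<nu> * q * c * s j * w \<noteq> 0)"

lemma c_nonzero: "c \<noteq> 0"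
  using q_nonzero nu_nonzero by (simp add: c_param_def)

lemma generically_good:
  assumes "k \<in> {1..n}"
  shows "generically n (\<lambda>u. good (u k))"
proof -
  have aff: "generically n (\<lambda>u. \<alpha> * u k + \<beta> \<noteq> 0)" if "\<alpha> \<noteq> 0" for \<alpha> \<beta>
    using generically_affine[OF poly_fun.const[of n 1] assms, of \<alpha> \<beta>] that by simp
  have *: "generically n (\<lambda>u. u k \<notin> S j \<and>
    s j + inverse \<nu> * q * u k \<noteq> 0 \<and> u k + inverse \<nu> * q * s j \<noteq> 0 \<and>
    u k - q\<^sup>2 * s j \<noteq> 0 \<and> u k - inverse q ^ 2 * s j \<noteq> 0 \<and>
    c * s j * u k - 1 \<noteq> 0 \<and> 1 + inverse \<nu> * q * c * s j * u k \<noteq> 0)" if "j \<in> {1..n}" for j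
  proof -
    have nz: "inverse \<nu> * q \<noteq> 0" "c * s j \<noteq> 0" "inverse \<nu> * q * c * s j \<noteq> 0"
      using q_nonzero nu_nonzero c_nonzero s_nonzero[of j] that by simp_all
    have "generically n (\<lambda>u. \<forall>a\<in>S j. u k \<noteq> a)"
      by (intro generically_ball finite_S generically_coord_neq assms)
    then have 1: "generically n (\<lambda>u. u k \<notin> S j)" by (rule generically_mono) blast
    show ?thesis
      by (intro generically_conj 1)
        (rule generically_mono[OF aff[OF nz(1), of "s j"]] generically_mono[OF aff[OF nz(2), of "-1"]]
          generically_mono[OF aff[OF nz(3), of 1]] generically_mono[OF aff[of 1 "inverse \<nu> * q * s j"]]
          generically_mono[OF aff[of 1 "- (q\<^sup>2 * s j)"]]
          generically_mono[OF aff[of 1 "- (inverse q ^ 2 * s j)"]]; simp add: add.commute; fail)+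
  qed
  show ?thesis
    unfolding good_def
    by (intro generically_conj generically_coord_neq assms generically_ball * finite_atLeastAtMost)
qed

text \<open>In the induction step e_k = p_k e_{k-1}. Unlike p_k, the factor e_{k-1} involves only
  y_j with j < k and so commutes with T_k, \<kappa>_k and Q_k. It is moved past Q_k to reach the
  inner function, where the induction hypothesis applies, and then moved back to restore e_k in
  front of Q_k.\<close>

lemma partial_idem_baxter_Y:
  assumes "1 \<le> k" "k \<le> n" "good w" "\<And>i. 1 \<le> i \<Longrightarrow> i < k \<Longrightarrow> u i = s i"
  shows "partial_idem (k - 1) * baxter_Y q \<nu> T k u w =
    partial_idem (k - 1) * ((c * w) *\<^sub>C y k - 1) * resolvent k w"
  using assms(1,2,4)
proof (induction k rule: nat_induct_at_least)
  case base
  have y1: "y 1 = 1" by (simp add: jucys_murphy_def)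
  have w1: "w - 1 \<noteq> 0" "w \<notin> S 1" using assms(3) base by (auto simp: good_def)
  have "resolvent 1 w * ((w - 1) *\<^sub>C 1) = 1"
    using resolvent_inverse(2)[of 1 w] base w1 y1
    by (simp add: complex_vector.scale_left_diff_distrib scaleC_one)
  then have "(w - 1) *\<^sub>C resolvent 1 w = 1" by (simp add: mult_scaleC_right)
  then have "inverse (w - 1) *\<^sub>C ((w - 1) *\<^sub>C resolvent 1 w) = inverse (w - 1) *\<^sub>C 1" by simp
  then have "resolvent 1 w = inverse (w - 1) *\<^sub>C 1" using w1 by (simp add: scaleC_one)
  moreover have "(c * w) *\<^sub>C y 1 - 1 = (c * w - 1) *\<^sub>C 1"
    unfolding y1 by (simp add: complex_vector.scale_left_diff_distrib scaleC_one)
  ultimately show ?case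
    by (simp add: partial_idem_0 mult_scaleC_left mult_scaleC_right divide_inverse mult.commute)
next
  case (Suc k)
  let ?e = "partial_idem k" and ?e' = "partial_idem (k - 1)" and ?P = "p k (s k)"
  let ?x = "y k" and ?y = "y (Suc k)" and ?R = "resolvent k w"
  let ?Q = "baxter_Q q \<nu> T k (s k) w c" and ?T = "baxter_T q \<nu> T k w (s k)"
  have k: "1 \<le> k" "k \<le> n" "k < n" "Suc k \<le> n" using Suc by simp_all
  obtain i where i: "k = Suc i" using k by (cases k) auto
  have uk: "u k = s k" using Suc.prems k by simp
  have e: "?e = ?P * ?e'"
  proof -
    have "?P * ?e' = ?e' * ?P"
      by (rule partial_idem_commute, rule p_commute[symmetric], rule jm_commute) (use k in auto)
    then show ?thesis by (simp add: i partial_idem_Suc)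
  qed
  have T_e': "T k * ?e' = ?e' * T k"
    by (rule partial_idem_commute, rule T_jucys_murphy_commute) (use k in auto)
  have "\<kappa> k * ?e' = ?e' * \<kappa> k"
    using conj_kappa[OF k(1,3,1,3), of ?e'] T_e' by simp
  then have Q_e': "?e' * ?Q = ?Q * ?e'"
    using T_e' by (simp add: baxter_Q_def distrib_left distrib_right mult_scaleC_left mult_scaleC_right)
  have y_e: "?e * ?y = ?y * ?e"
    by (rule partial_idem_commute[symmetric], rule jm_commute) (use k in auto)
  have g: "w \<noteq> 0" "w \<noteq> s k" "w \<notin> S k" "w \<notin> S (Suc k)"
    "s k + inverse \<nu> * q * w \<noteq> 0" "w + inverse \<nu> * q * s k \<noteq> 0"
    "w - q\<^sup>2 * s k \<noteq> 0" "w - inverse q ^ 2 * s k \<noteq> 0"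
    "c * s k * w - 1 \<noteq> 0" "1 + inverse \<nu> * q * c * s k * w \<noteq> 0"
    using assms(3) k s_in_S[of k] by (auto simp: good_def)
  note inv = ring_inv_baxter_T[OF k(1,3) g(1,2,5-8)]
  have sk: "s k \<noteq> 0" using s_nonzero k by simp
  \<comment> \<open>The value of c enters here: the first identity matches the \<kappa>-pole of Q
    with the zero of w - \<nu>^2/s_k, the second that of T with the zero of c w \<nu>^2/s_k -
    1.\<close>
  have c\<nu>: "inverse \<nu> * q * c = - inverse (\<nu>\<^sup>2)" "c * \<nu>\<^sup>2 = - \<nu> / q"
    using q_nonzero nu_nonzero by (simp_all add: c_param_def field_simps power2_eq_square)
  have refl_id: "?e * (w *\<^sub>C 1 - ?y) * ?Q * ((c * w) *\<^sub>C ?x - 1) =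
      ?e * ((c * w) *\<^sub>C ?y - 1) * ?T * (w *\<^sub>C 1 - ?x)"
    unfolding baxter_Q_def baxter_T_def
  proof (rule reflection_identity[where s = "s k"])
    show "?y = T k * ?x * T k" using k by (simp add: jucys_murphy_Suc)
    show "T k * T k = 1 + l *\<^sub>C T k - (l * \<nu>) *\<^sub>C \<kappa> k" by (rule T_square[OF k(1,3)])
    show "T k * \<kappa> k = \<nu> *\<^sub>C \<kappa> k" by (rule T_kappa[OF k(1,3)])
    show "?x * ?y * \<kappa> k = \<nu>\<^sup>2 *\<^sub>C \<kappa> k" by (rule jucys_murphy_kappa[OF k(1,3)])
    show "?e * ?x = s k *\<^sub>C ?e" by (rule partial_idem_jm[OF k(1,2)])
    show "?e * ?y = ?y * ?e" by (rule y_e)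
    show "s k \<noteq> 0" "\<nu> \<noteq> 0" by (fact sk nu_nonzero)+
    show "l / (c * s k * w - 1) * (c * s k * w - 1) = l" using g by simp
    show "l / (s k / w - 1) * (s k - w) = l * w" using g by (simp add: field_simps)
    show "l / (1 + inverse \<nu> * q * c * s k * w) * (w - \<nu>\<^sup>2 / s k) = - l * \<nu>\<^sup>2 / s k"
    proof -
      have "w - \<nu>\<^sup>2 / s k = - (\<nu>\<^sup>2 / s k) * (1 + inverse \<nu> * q * c * s k * w)"
        unfolding c\<nu> using sk nu_nonzero by (simp add: field_simps)
      then have "a / (1 + inverse \<nu> * q * c * s k * w) * (w - \<nu>\<^sup>2 / s k) = - a * \<nu>\<^sup>2 / s k" for a
        using g(10) by simp
      then show ?thesis .
    qed
    show "l / (1 + inverse \<nu> * q * (s k / w)) * (c * w * \<nu>\<^sup>2 / s k - 1) = c * w * l * \<nu>\<^sup>2 / s k"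
    proof -
      have "c * w * \<nu>\<^sup>2 / s k - 1 = (c * \<nu>\<^sup>2) * w / s k - 1" by (simp add: mult_ac)
      also have "\<dots> = (c * \<nu>\<^sup>2) * w / s k * (1 + inverse \<nu> * q * (s k / w))"
        unfolding c\<nu> using sk nu_nonzero q_nonzero g(1) by (simp add: field_simps)
      finally have *: "c * w * \<nu>\<^sup>2 / s k - 1 = (c * \<nu>\<^sup>2) * w / s k * (1 + inverse \<nu> * q * (s k / w))" .
      have "1 + inverse \<nu> * q * (s k / w) = (w + inverse \<nu> * q * s k) / w"
        using g(1) by (simp add: add_divide_distrib)
      then have "1 + inverse \<nu> * q * (s k / w) \<noteq> 0" using g(1,6) by simp
      then show ?thesis unfolding * by simp
    qed
  qed
  have IH: "?e' * baxter_Y q \<nu> T k u w = ?e' * ((c * w) *\<^sub>C ?x - 1) * ?R"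
    using Suc by simp
  have "?e * baxter_Y q \<nu> T (Suc k) u w = ?e * ?Q * baxter_Y q \<nu> T k u w * ring_inv ?T"
    by (simp add: i uk[unfolded i] mult.assoc)
  also have "\<dots> = ?P * (?e' * ?Q) * baxter_Y q \<nu> T k u w * ring_inv ?T"
    by (simp only: e mult.assoc)
  also have "\<dots> = ?P * ?Q * (?e' * baxter_Y q \<nu> T k u w) * ring_inv ?T"
    by (simp only: Q_e') (simp only: mult.assoc)
  also have "\<dots> = ?P * (?Q * ?e') * ((c * w) *\<^sub>C ?x - 1) * ?R * ring_inv ?T"
    by (simp only: IH) (simp only: mult.assoc)
  also have "\<dots> = ?e * ?Q * ((c * w) *\<^sub>C ?x - 1) * ?R * ring_inv ?T"
    by (simp only: Q_e'[symmetric] e) (simp only: mult.assoc)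
  finally have step: "?e * baxter_Y q \<nu> T (Suc k) u w =
      ?e * ?Q * ((c * w) *\<^sub>C ?x - 1) * ?R * ring_inv ?T" .
  have comm: "(w *\<^sub>C 1 - ?y) * ?e = ?e * (w *\<^sub>C 1 - ?y)"
    using y_e by (simp add: left_diff_distrib right_diff_distrib mult_scaleC_left mult_scaleC_right)
  have poly_comm: "((c * w) *\<^sub>C ?y - 1) * ((w *\<^sub>C 1 - ?y) * z) = (w *\<^sub>C 1 - ?y) * (((c * w) *\<^sub>C ?y - 1) * z)"
    for z
    by (simp add: left_diff_distrib right_diff_distrib scaleC_simps scaleC_one)
  \<comment> \<open>The factor \<open>w *\<^sub>C 1 - ?y\<close> is supplied on the left so that the
    reflection equation can be used. Its other side ends in
    \<open>?T * (w *\<^sub>C 1 - ?x)\<close>, which cancels against the resolvent and the inverse of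
    \<open>?T\<close>; the supplied factor is then removed by the next resolvent.\<close>
  have "(w *\<^sub>C 1 - ?y) * (?e * baxter_Y q \<nu> T (Suc k) u w) =
      ?e * (w *\<^sub>C 1 - ?y) * ?Q * ((c * w) *\<^sub>C ?x - 1) * ?R * ring_inv ?T"
    unfolding step comm[symmetric] by (simp add: mult.assoc)
  also have "\<dots> = ?e * ((c * w) *\<^sub>C ?y - 1) * ?T * ((w *\<^sub>C 1 - ?x) * ?R) * ring_inv ?T"
    unfolding refl_id by (simp add: mult.assoc)
  also have "\<dots> = ?e * ((c * w) *\<^sub>C ?y - 1)"
    by (simp only: resolvent_inverse(1)[OF k(1,2) g(3)] mult_1_right) (simp add: mult.assoc inv)
  also have "\<dots> = ?e * ((c * w) *\<^sub>C ?y - 1) * (resolvent (Suc k) w * (w *\<^sub>C 1 - ?y))"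
    using resolvent_inverse(2)[of "Suc k" w] k g(4) by simp
  also have "\<dots> = ?e * ((c * w) *\<^sub>C ?y - 1) * ((w *\<^sub>C 1 - ?y) * resolvent (Suc k) w)"
    using resolvent_inverse[of "Suc k" w] k g(4) by simp
  also have "\<dots> = ?e * (w *\<^sub>C 1 - ?y) * ((c * w) *\<^sub>C ?y - 1) * resolvent (Suc k) w"
    by (simp only: mult.assoc[symmetric]) (simp only: mult.assoc poly_comm)
  also have "\<dots> = (w *\<^sub>C 1 - ?y) * (?e * ((c * w) *\<^sub>C ?y - 1) * resolvent (Suc k) w)"
    unfolding comm[symmetric] by (simp add: mult.assoc)
  finally have "resolvent (Suc k) w * ((w *\<^sub>C 1 - ?y) * (?e * baxter_Y q \<nu> T (Suc k) u w)) =
      resolvent (Suc k) w * ((w *\<^sub>C 1 - ?y) * (?e * ((c * w) *\<^sub>C ?y - 1) * resolvent (Suc k) w))"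
    by (rule arg_cong)
  then show ?case
    using resolvent_inverse(2)[of "Suc k" w] k g(4) by (simp add: mult.assoc[symmetric])
qed

text \<open>Partial fractions in \<open>w\<close>: only the summand with a = s_k has a pole at w =
  s_k, and its algebra factor is \<open>partial_idem k\<close>.\<close>

lemma partial_idem_baxter_Y_sum:
  assumes "1 \<le> k" "k \<le> n" "good w" "\<And>i. 1 \<le> i \<Longrightarrow> i < k \<Longrightarrow> u i = s i"
  shows "partial_idem (k - 1) * baxter_Y q \<nu> T k u w =
    (\<Sum>a\<in>S k. ((c * w * a - 1) / (w - a)) *\<^sub>C (partial_idem (k - 1) * p k a))"
proof -
  have "((c * w) *\<^sub>C y k - 1) * (inverse (w - a) *\<^sub>C p k a) = ((c * w * a - 1) / (w - a)) *\<^sub>C p k a"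
    if "a \<in> S k" for a
  proof -
    have "((c * w) *\<^sub>C y k - 1) * p k a = (c * w * a - 1) *\<^sub>C p k a"
      using jm_p[OF assms(1,2) that]
      by (simp add: left_diff_distrib mult_scaleC_left complex_vector.scale_left_diff_distrib scaleC_one)
    then show ?thesis by (simp add: mult_scaleC_right divide_inverse mult.commute)
  qed
  then have "((c * w) *\<^sub>C y k - 1) * resolvent k w = (\<Sum>a\<in>S k. ((c * w * a - 1) / (w - a)) *\<^sub>C p k a)"
    unfolding resolvent_def sum_distrib_left by (rule sum.cong[OF refl])
  then have "partial_idem (k - 1) * baxter_Y q \<nu> T k u w =
      partial_idem (k - 1) * (\<Sum>a\<in>S k. ((c * w * a - 1) / (w - a)) *\<^sub>C p k a)"
    using partial_idem_baxter_Y[OF assms] by (simp add: mult.assoc)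
  then show ?thesis by (simp only: sum_distrib_left mult_scaleC_right)
qed

section \<open>The intermediate functions between successive evaluations\<close>

definition specialize :: "nat \<Rightarrow> (nat \<Rightarrow> complex) \<Rightarrow> nat \<Rightarrow> complex"
  where "specialize k u = (\<lambda>i. if 1 \<le> i \<and> i \<le> k then s i else u i)"

text \<open>Stated for every \<open>m \<le> j\<close>, because the recursion lowers the index of the
  function but keeps \<open>u j\<close> as its last argument. The other parameter of each Baxterized
  factor has index below \<open>j\<close>, hence does not depend on \<open>u j\<close>, and freedom
  of \<open>u j\<close> ensures regularity.\<close>

lemma evaluates_to_baxter_Y:
  assumes k: "1 \<le> k" "k \<le> n" and j: "k < j" "j \<le> n" and m: "1 \<le> m" "m \<le> j"
  shows "evaluates_to n k (s k) (\<lambda>u. baxter_Y q \<nu> T m (specialize (k - 1) u) (u j))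
    (\<lambda>u. baxter_Y q \<nu> T m (specialize k u) (u j))"
  using m
proof (induction m rule: nat_induct_at_least)
  case base
  have "evaluates_to n k (s k) (\<lambda>u. (c * u j - 1) / (u j - 1))
      (\<lambda>u. (c * (u(k := s k)) j - 1) / ((u(k := s k)) j - 1))"
    by (rule evaluates_to_divide[where u = "\<lambda>_. 0"]) (use j k in \<open>auto intro!: poly_fun_intros\<close>)
  then have "evaluates_to n k (s k) (\<lambda>u. (c * u j - 1) / (u j - 1)) (\<lambda>u. (c * u j - 1) / (u j - 1))"
    using j by simp
  then show ?case
    by (auto intro!: evaluates_to_scaleC evaluates_to_const)
next
  case (Suc m)
  obtain i where i: "m = Suc i" using Suc by (cases m) auto
  define x where "x u = specialize (k - 1) u m" for u
  have x: "poly_fun n x"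
    using Suc j k unfolding x_def specialize_def
    by (cases "m \<le> k - 1") (auto intro!: poly_fun_intros)
  have x_eval: "x (u(k := s k)) = specialize k u m" for u
    using k Suc by (auto simp: x_def specialize_def)
  have indep: "x (u(j := t)) = x u" for u t
    using Suc by (auto simp: x_def specialize_def)
  have j': "j \<in> {1..n}" "j \<noteq> k" using j by auto
  have "evaluates_to n k (s k)
      (\<lambda>u. baxter_Q q \<nu> T m (x u) (u j) c * baxter_Y q \<nu> T m (specialize (k - 1) u) (u j) *
        ring_inv (baxter_T q \<nu> T m (u j) (x u)))
      (\<lambda>u. baxter_Q q \<nu> T m (x (u(k := s k))) (u j) c * baxter_Y q \<nu> T m (specialize k u) (u j) *
        ring_inv (baxter_T q \<nu> T m (u j) (x (u(k := s k)))))"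
    by (intro evaluates_to_mult evaluates_to_baxter_Q[OF x j']
        evaluates_to_ring_inv_baxter_T[OF x j' indep] Suc.IH) (use Suc j in auto)
  then show ?case unfolding x_eval unfolding x_def by (simp add: i)
qed

definition prefactor :: "nat \<Rightarrow> (nat \<Rightarrow> complex) \<Rightarrow> complex"
  where "prefactor k u = (\<Prod>j = Suc k..n. (u j - s j) / (c * u j * s j - 1))"

text \<open>The explicit candidate for the result of the first \<open>k\<close> evaluations: the
  evaluated factors have collapsed to \<open>partial_idem k\<close>, and their scalar prefactors
  have been used up.\<close>

definition stage :: "nat \<Rightarrow> (nat \<Rightarrow> complex) \<Rightarrow> 'a"
  where "stage k u = prefactor k u *\<^sub>C (partial_idem k *
    prod_list (map (\<lambda>j. baxter_Y q \<nu> T j (specialize k u) (u j)) [Suc k..<Suc n]))"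

lemma evaluates_to_prefactor:
  assumes "1 \<le> k"
  shows "evaluates_to n k (s k) (prefactor k) (prefactor k)"
  unfolding prefactor_def
proof (rule evaluates_to_prod)
  fix j assume j: "j \<in> {Suc k..n}"
  have "evaluates_to n k (s k) (\<lambda>u. (u j - s j) / (c * u j * s j - 1))
      (\<lambda>u. ((u(k := s k)) j - s j) / (c * (u(k := s k)) j * s j - 1))"
    by (rule evaluates_to_divide[where u = "\<lambda>_. 0"]) (use j in \<open>auto intro!: poly_fun_intros\<close>)
  then show "evaluates_to n k (s k) (\<lambda>u. (u j - s j) / (c * u j * s j - 1))
      (\<lambda>u. (u j - s j) / (c * u j * s j - 1))"
    using j by simp
qed simp

text \<open>The scalar factor of index \<open>k\<close> multiplies each partial fraction of e_{k-1}
  Y_k. The summand a = s_k becomes the constant e_k, every other summand acquires a zero at u_k =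
  s_k, and the remaining factors are regular there.\<close>

lemma evaluates_to_stage:
  assumes k: "1 \<le> k" "k \<le> n"
  shows "evaluates_to n k (s k) (stage (k - 1)) (stage k)"
proof -
  let ?f = "\<lambda>a w. ((w - s k) * (c * w * a - 1)) / ((c * w * s k - 1) * (w - a))"
  let ?Y = "\<lambda>k' u. prod_list (map (\<lambda>j. baxter_Y q \<nu> T j (specialize k' u) (u j)) [Suc k..<Suc n])"
  let ?A = "\<lambda>u. partial_idem k + (\<Sum>a\<in>S k - {s k}. ?f a (u k) *\<^sub>C (partial_idem (k - 1) * p k a))"
  have Suc_k: "Suc (k - 1) = k" using k by simp
  have "stage (k - 1) u = prefactor k u *\<^sub>C (?A u * ?Y (k - 1) u)" if "good (u k)" for u
  proof -
    let ?w = "u k" and ?e = "partial_idem (k - 1)"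
    have w: "?w - s k \<noteq> 0" "c * ?w * s k - 1 \<noteq> 0"
      using that k s_in_S[of k] by (auto simp: good_def mult_ac)
    have coeff: "(?w - s k) / (c * ?w * s k - 1) * ((c * ?w * a - 1) / (?w - a)) = ?f a ?w" for a
      by simp
    have "((?w - s k) / (c * ?w * s k - 1)) *\<^sub>C
        (?e * baxter_Y q \<nu> T k (specialize (k - 1) u) ?w) =
        (\<Sum>a\<in>S k. ?f a ?w *\<^sub>C (?e * p k a))"
      by (subst partial_idem_baxter_Y_sum[OF k that])
        (auto simp: specialize_def complex_vector.scale_sum_right)
    also have "\<dots> = ?f (s k) ?w *\<^sub>C (?e * p k (s k)) + (\<Sum>a\<in>S k - {s k}. ?f a ?w *\<^sub>C (?e * p k a))"
      by (rule sum.remove[OF finite_S s_in_S])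
    \<comment> \<open>For a = s_k numerator and denominator of \<open>?f\<close> coincide: the zero
      of the prefactor removes the pole exactly, with value 1.\<close>
    also have "?f (s k) ?w *\<^sub>C (?e * p k (s k)) = partial_idem k"
      using w partial_idem_Suc[of "k - 1"] Suc_k by (simp add: scaleC_one)
    finally have A: "((?w - s k) / (c * ?w * s k - 1)) *\<^sub>C
        (?e * baxter_Y q \<nu> T k (specialize (k - 1) u) ?w) = ?A u" .
    have "prefactor (k - 1) u = prefactor k u * ((?w - s k) / (c * ?w * s k - 1))"
      unfolding prefactor_def Suc_k using k by (simp add: prod.atLeast_Suc_atMost mult.commute)
    moreover have "[k..<Suc n] = k # [Suc k..<Suc n]"
      using k by (simp add: upt_conv_Cons del: upt_Suc)
    ultimately show ?thesis
      unfolding stage_def Suc_k A[symmetric]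
      by (simp add: mult_scaleC_left mult.assoc del: upt_Suc)
  qed
  then have gen: "generically n (\<lambda>u. stage (k - 1) u = prefactor k u *\<^sub>C (?A u * ?Y (k - 1) u))"
    using generically_mono[OF generically_good[of k]] k by simp
  \<comment> \<open>The numerator vanishes at w = s_k, while the denominator becomes (c s_k^2 -
    1)(s_k - a), nonzero by genericity and a \<noteq> s_k.\<close>
  have f: "evaluates_to n k (s k) (\<lambda>u. ?f a (u k)) (\<lambda>_. 0)" if "a \<in> S k - {s k}" for a
  proof -
    have "c * s k * s k - 1 \<noteq> 0"
      using s_generic[OF k] by (simp add: power2_eq_square mult.assoc)
    then have "(c * s k * s k - 1) * (s k - a) \<noteq> 0" using that by auto
    then have "evaluates_to n k (s k) (\<lambda>u. ?f a (u k)) (\<lambda>u. ?f a ((u(k := s k)) k))"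
      by (intro evaluates_to_divide[where u = "\<lambda>_. 0"]) (use k in \<open>auto intro!: poly_fun_intros\<close>)
    then show ?thesis by simp
  qed
  have A: "evaluates_to n k (s k) ?A
      (\<lambda>_. partial_idem k + (\<Sum>a\<in>S k - {s k}. 0 *\<^sub>C (partial_idem (k - 1) * p k a)))"
    by (intro evaluates_to_add evaluates_to_const evaluates_to_sum evaluates_to_scaleC f)
      (use finite_S in auto)
  have Y: "evaluates_to n k (s k) (?Y (k - 1)) (?Y k)"
    by (rule evaluates_to_prod_list, rule evaluates_to_baxter_Y[OF k]) auto
  have "evaluates_to n k (s k) (\<lambda>u. prefactor k u *\<^sub>C (?A u * ?Y (k - 1) u))
      (\<lambda>u. prefactor k u *\<^sub>C ((partial_idem k + (\<Sum>a\<in>S k - {s k}. 0 *\<^sub>C (partial_idem (k - 1) * p k a)))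
        * ?Y k u))"
    by (intro evaluates_to_scaleC[OF evaluates_to_prefactor[OF k(1)]] evaluates_to_mult A Y)
  then show ?thesis
    by (rule evaluates_to_cong[OF _ gen]) (simp add: generically_True stage_def)
qed

lemma consecutive_evaluation_stage:
  "consecutive_evaluation n s (stage 0) (partial_idem n)"
  unfolding consecutive_evaluation_def
proof (intro exI[of _ stage] conjI ballI refl)
  show "evaluates_to n k (s k) (stage (k - 1)) (stage k)" if "k \<in> {1..n}" for k
    using evaluates_to_stage that by simp
  show "rat_eq n (stage n) (\<lambda>_. partial_idem n)"
    by (simp add: rat_eq_generically generically_True stage_def prefactor_def scaleC_one)
qed

end

section \<open>Identification of the idempotent\<close>

lemma subalgebra_bmw_sub: "subalgebra (bmw_sub T k)"
  unfolding bmw_sub_def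
  by (rule hull_in) (auto simp: subalgebra_def complex_vector.subspace_def)

context bmw_relations
begin

text \<open>Solving the quadratic relation for \<open>\<kappa>\<close> expresses the inverse generators as polynomials in
  the generators.\<close>

lemma bmw_sub_ring_inv:
  assumes "1 \<le> i" "i < n"
  shows "ring_inv (T i) \<in> bmw_sub T n"
proof -
  note sub = subalgebra_bmw_sub[of T n, unfolded subalgebra_def]
  have space: "complex_vector.subspace (bmw_sub T n)" using sub by simp
  note closed = complex_vector.subspace_diff[OF space] complex_vector.subspace_scale[OF space]
    complex_vector.subspace_add[OF space]
  have T: "T i \<in> bmw_sub T n"
    unfolding bmw_sub_def using hull_subset[of "T ` {1..<n}" subalgebra] assms by auto
  have mult: "x * y \<in> bmw_sub T n"
    if "x \<in> bmw_sub T n" "y \<in> bmw_sub T n" for x y using sub that by auto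
  have one: "1 \<in> bmw_sub T n" using sub by simp
  have "(l * \<nu>) *\<^sub>C \<kappa> i = 1 + l *\<^sub>C T i - T i * T i"
    using T_square[OF assms] by simp
  then have "inverse (l * \<nu>) *\<^sub>C ((l * \<nu>) *\<^sub>C \<kappa> i) = inverse (l * \<nu>) *\<^sub>C (1 + l *\<^sub>C T i - T i * T i)"
    by (rule arg_cong)
  moreover have "inverse (l * \<nu>) *\<^sub>C ((l * \<nu>) *\<^sub>C \<kappa> i) = \<kappa> i"
    using q_generic nu_nonzero by (simp add: scaleC_one del: inverse_mult_distrib)
  ultimately have "\<kappa> i = inverse (l * \<nu>) *\<^sub>C (1 + l *\<^sub>C T i - T i * T i)" by simp
  moreover have "\<dots> \<in> bmw_sub T n"
    by (intro closed mult T one)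
  ultimately have "\<kappa> i \<in> bmw_sub T n" by (rule ssubst)
  moreover have "ring_inv (T i) = T i - l *\<^sub>C (1 - \<kappa> i)"
    unfolding l_kappa by simp
  moreover have "T i - l *\<^sub>C (1 - \<kappa> i) \<in> bmw_sub T n"
    by (intro closed T one) fact
  ultimately show ?thesis by simp
qed

text \<open>Turns the semisimplicity and the classification assumed for the top algebra of the chain
  into statements about the whole type. It holds because every word in the generators and their
  inverses lies in the subalgebra.\<close>

lemma bmw_sub_UNIV:
  assumes "is_bmw n q \<nu> T"
  shows "bmw_sub T n = UNIV"
proof -
  let ?f = "\<lambda>g. case g of Gen i \<Rightarrow> T i | GenInv i \<Rightarrow> ring_inv (T i)"
  note sub = subalgebra_bmw_sub[of T n, unfolded subalgebra_def]
  have space: "complex_vector.subspace (bmw_sub T n)" using sub by simp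
  have gen: "?f g \<in> bmw_sub T n" if "g \<in> bmw_gens n" for g
    using that bmw_sub_ring_inv hull_subset[of "T ` {1..<n}" subalgebra]
    by (auto simp: bmw_gens_def bmw_sub_def)
  have word: "prod_list (map ?f xs) \<in> bmw_sub T n" if "set xs \<subseteq> bmw_gens n" for xs
    using that sub gen by (induction xs) auto
  have "free_eval ?f r \<in> bmw_sub T n" if "r \<in> free_on (bmw_gens n)" for r
    unfolding free_eval_def
    using that
    by (intro complex_vector.subspace_sum[OF space] complex_vector.subspace_scale[OF space] word)
      (auto simp: free_on_def)
  moreover have "free_eval ?f ` free_on (bmw_gens n) = UNIV"
    using assms unfolding is_bmw_def presented_by_def by (rule conjunct1)
  ultimately have "UNIV \<subseteq> bmw_sub T n" by (metis image_subsetI)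
  then show ?thesis by (rule top.extremum_uniqueI)
qed

end

text \<open>A box (a, b) forces a full a by b rectangle into the diagram, so a b \<le> n and the box
  lies in an n by n square. This makes the joint spectrum of the Jucys--Murphy elements
  finite.\<close>

lemma finite_shapes: "finite (shapes n)"
proof (rule finite_subset)
  show "shapes n \<subseteq> Pow ({1..n} \<times> {1..n})"
  proof (intro subsetI PowI)
    fix \<Lambda> x assume \<Lambda>: "\<Lambda> \<in> shapes n" and "x \<in> \<Lambda>"
    obtain a b where x: "x = (a, b)" by (cases x)
    then have ab: "1 \<le> a" "1 \<le> b" "{1..a} \<times> {1..b} \<subseteq> \<Lambda>" "finite \<Lambda>" "card \<Lambda> \<le> n"
      using \<Lambda> \<open>x \<in> \<Lambda>\<close> by (auto simp: shapes_def young_diagram_def)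
    have "a * b \<le> n"
      using card_mono[OF ab(4,3)] ab(5) by (simp add: card_cartesian_product)
    moreover have "a \<le> a * b" "b \<le> a * b" using ab(1,2) by simp_all
    ultimately have "a \<le> n" "b \<le> n" by linarith+
    then show "x \<in> {1..n} \<times> {1..n}" using ab x by simp
  qed
qed simp

lemma content_nonzero:
  assumes "q \<noteq> 0" "\<nu> \<noteq> 0"
  shows "content q \<nu> U j \<noteq> 0"
  using assms by (simp add: content_def Let_def split: prod.split)

text \<open>The Lagrange basis polynomial for the node \<open>a\<close>, applied to
  \<open>y\<close>. The same definition serves for algebra elements and for their complex
  eigenvalues. Repeated entries of \<open>xs\<close> are harmless, since each factor is 1 at
  \<open>a\<close> and 0 at its own node.\<close>

definition lagrange :: "complex list \<Rightarrow> complex \<Rightarrow> 'a::complex_algebra_1 \<Rightarrow> 'a"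
  where "lagrange xs a y =
    prod_list (map (\<lambda>b. inverse (a - b) *\<^sub>C (y - b *\<^sub>C 1)) (filter (\<lambda>b. b \<noteq> a) xs))"

lemma lagrange_commute: "z * y = y * z \<Longrightarrow> z * lagrange xs a y = lagrange xs a y * z"
  unfolding lagrange_def
  by (rule commute_prod_list)
    (auto simp: mult_scaleC_left mult_scaleC_right left_diff_distrib right_diff_distrib)

lemma lagrange_complex:
  fixes v :: complex
  assumes "v \<in> set xs"
  shows "lagrange xs a v = of_bool (v = a)"
proof (cases "v = a")
  case True
  have ones: "map (\<lambda>b. inverse (a - b) *\<^sub>C (v - b *\<^sub>C 1)) (filter (\<lambda>b. b \<noteq> a) xs) =
      map (\<lambda>_. 1) (filter (\<lambda>b. b \<noteq> a) xs)"
  proof (rule map_cong[OF refl])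
    fix b assume "b \<in> set (filter (\<lambda>b. b \<noteq> a) xs)"
    then have "a - b \<noteq> 0" by auto
    then show "inverse (a - b) *\<^sub>C (v - b *\<^sub>C 1) = 1"
      using True by (simp add: scaleC_complex_def)
  qed
  have "prod_list (map (\<lambda>_. 1 :: complex) ys) = 1" for ys :: "complex list"
    by (induction ys) simp_all
  then show ?thesis unfolding lagrange_def ones using True by simp
next
  case False
  then have "0 \<in> set (map (\<lambda>b. inverse (a - b) *\<^sub>C (v - b *\<^sub>C 1)) (filter (\<lambda>b. b \<noteq> a) xs))"
    using assms by (auto simp: scaleC_complex_def intro!: image_eqI[of _ _ v])
  then show ?thesis using False by (simp add: lagrange_def prod_list_zero_iff)
qed

text \<open>Under joint faithfulness, an identity between elements acting diagonally reduces to an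
  identity between their eigenvalues.\<close>

locale faithful_reps =
  fixes L :: "'l set" and I :: "'l \<Rightarrow> 'i set"
    and \<rho> :: "'l \<Rightarrow> 'a::complex_algebra_1 \<Rightarrow> 'i \<Rightarrow> 'i \<Rightarrow> complex"
  assumes rep: "h \<in> L \<Longrightarrow> matrix_rep UNIV (I h) (\<rho> h)"
    and faithful: "(\<And>h i j. h \<in> L \<Longrightarrow> i \<in> I h \<Longrightarrow> j \<in> I h \<Longrightarrow> \<rho> h x i j = 0) \<Longrightarrow> x = 0"
begin

text \<open>One function \<open>f\<close> records the eigenvalues for all representations at once;
  this suits tableaux, as a tableau determines its shape.\<close>

definition diag :: "'a \<Rightarrow> ('i \<Rightarrow> complex) \<Rightarrow> bool"
  where "diag x f \<longleftrightarrow> (\<forall>h\<in>L. \<forall>i\<in>I h. \<forall>j\<in>I h. \<rho> h x i j = f j * of_bool (i = j))"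

lemma diag_one: "diag 1 (\<lambda>_. 1)"
  using rep by (simp add: diag_def matrix_rep_def)

lemma diag_scaleC: "diag x f \<Longrightarrow> diag (a *\<^sub>C x) (\<lambda>j. a * f j)"
  using rep by (simp add: diag_def matrix_rep_def mult.assoc)

lemma diag_add: "diag x f \<Longrightarrow> diag y g \<Longrightarrow> diag (x + y) (\<lambda>j. f j + g j)"
  using rep by (simp add: diag_def matrix_rep_def distrib_right)

lemma diag_diff: "diag x f \<Longrightarrow> diag y g \<Longrightarrow> diag (x - y) (\<lambda>j. f j - g j)"
  using diag_add[of x f "(-1) *\<^sub>C y" "\<lambda>j. - 1 * g j"] diag_scaleC[of y g "-1"]
  by (simp add: scaleC_one)

lemma diag_zero: "diag 0 (\<lambda>_. 0)"
  using diag_scaleC[OF diag_one, of 0] by simp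

lemma diag_sum:
  "finite K \<Longrightarrow> (\<And>k. k \<in> K \<Longrightarrow> diag (x k) (f k)) \<Longrightarrow> diag (\<Sum>k\<in>K. x k) (\<lambda>j. \<Sum>k\<in>K. f k j)"
  by (induction rule: finite_induct) (simp_all add: diag_zero diag_add)

lemma diag_mult:
  assumes "diag x f" "diag y g"
  shows "diag (x * y) (\<lambda>j. f j * g j)"
  unfolding diag_def
proof (intro ballI)
  fix h i j assume h: "h \<in> L" and ij: "i \<in> I h" "j \<in> I h"
  have "\<rho> h (x * y) i j = (\<Sum>k\<in>I h. \<rho> h x i k * \<rho> h y k j)"
    using rep[OF h] ij by (simp add: matrix_rep_def)
  also have "\<dots> = (\<Sum>k\<in>I h. if k = j then f j * g j * of_bool (i = j) else 0)"
    using assms h ij by (intro sum.cong) (auto simp: diag_def)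
  also have "\<dots> = f j * g j * of_bool (i = j)"
    using rep[OF h] ij by (simp add: matrix_rep_def)
  finally show "\<rho> h (x * y) i j = f j * g j * of_bool (i = j)" .
qed

lemma diag_prod_list:
  "(\<And>k. k \<in> set ks \<Longrightarrow> diag (x k) (f k)) \<Longrightarrow>
    diag (prod_list (map x ks)) (\<lambda>j. prod_list (map (\<lambda>k. f k j) ks))"
  by (induction ks) (simp_all add: diag_one diag_mult)

lemma diag_lagrange:
  assumes "diag y f"
  shows "diag (lagrange xs a y) (\<lambda>j. lagrange xs a (f j))"
  unfolding lagrange_def
proof (rule diag_prod_list)
  fix b
  show "diag (inverse (a - b) *\<^sub>C (y - b *\<^sub>C 1)) (\<lambda>j. inverse (a - b) *\<^sub>C (f j - b *\<^sub>C 1))"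
    using diag_scaleC[OF diag_diff[OF assms diag_scaleC[OF diag_one]]]
    by (simp add: scaleC_complex_def)
qed

lemma diag_unique:
  assumes "diag x f" "diag y g" "\<And>h j. h \<in> L \<Longrightarrow> j \<in> I h \<Longrightarrow> f j = g j"
  shows "x = y"
proof -
  have "x - y = 0"
    by (rule faithful) (use diag_diff[OF assms(1,2)] assms(3) in \<open>simp add: diag_def\<close>)
  then show ?thesis by simp
qed

end

theorem theorem2:
  fixes n :: nat and q \<nu> :: complex
    and T :: "nat \<Rightarrow> 'a::complex_algebra_1"
    and \<rho> :: "nat \<Rightarrow> diagram \<Rightarrow> 'a \<Rightarrow> diagram list \<Rightarrow> diagram list \<Rightarrow> complex"
    and U :: "diagram list" and E :: 'a
  assumes "n \<ge> 1"
    and "is_bmw n q \<nu> T"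
    and "generic_params n q \<nu> T"
    and "labelled_irreps n q \<nu> T \<rho>"
    and "updown_branching n T \<rho>"
    and "updown_tableau U" and "length U = n"
    and "is_tableau_idempotent n \<rho> U E"
  shows "consecutive_evaluation n (content q \<nu> U) (Psi n q \<nu> T U) E"
proof -
  have params: "q \<noteq> 0" "\<nu> \<noteq> 0" "q - inverse q \<noteq> 0" "\<forall>k\<in>{1..n}. semisimple (bmw_sub T k)"
    and separate: "\<forall>U V. updown_tableau U \<and> updown_tableau V \<and> length U = length V \<and> length U \<le> n \<and>
      (\<forall>j\<in>{1..length U}. content q \<nu> U j = content q \<nu> V j) \<longrightarrow> U = V"
    and generic: "\<forall>U. updown_tableau U \<and> length U \<le> n \<longrightarrow>
      (\<forall>j\<in>{1..length U}. c_param q \<nu> * (content q \<nu> U j)\<^sup>2 \<noteq> 1)"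
    using assms(3)[unfolded generic_params_def] by - (elim conjE, assumption)+
  have n: "n \<in> {1..n}" using assms(1) by simp
  have unique: "W = U" if "updown_tableau W" "length W = n"
    "\<forall>j\<in>{1..n}. content q \<nu> W j = content q \<nu> U j" for W
    by (rule separate[rule_format]) (use assms(6,7) that in simp)
  interpret bmw: bmw_relations n q \<nu> T
    by (rule is_bmw_relations[OF assms(2) params(1-3)])
  have UNIV: "bmw_sub T n = UNIV" by (rule bmw.bmw_sub_UNIV[OF assms(2)])
  have irreps: "\<forall>\<Lambda>\<in>shapes n. irreducible_rep UNIV (tableaux n \<Lambda>) (\<rho> n \<Lambda>)"
    "\<forall>(I :: nat set) \<sigma>. irreducible_rep (UNIV :: 'a set) I \<sigma> \<longrightarrow>
      (\<exists>\<Lambda>\<in>shapes n. equivalent_reps UNIV I \<sigma> (tableaux n \<Lambda>) (\<rho> n \<Lambda>))"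
    "\<forall>\<Lambda>\<in>shapes n. \<forall>U\<in>tableaux n \<Lambda>. \<forall>V\<in>tableaux n \<Lambda>. \<forall>j\<in>{1..n}.
      \<rho> n \<Lambda> (jucys_murphy T j) V U = content q \<nu> U j * of_bool (V = U)"
    using bspec[OF assms(4)[unfolded labelled_irreps_def] n, unfolded UNIV]
    by - (elim conjE, assumption)+
  have rep: "matrix_rep UNIV (tableaux n \<Lambda>) (\<rho> n \<Lambda>)" if "\<Lambda> \<in> shapes n" for \<Lambda>
    using irreps(1) that by (simp add: irreducible_rep_def)
  interpret faithful_reps "shapes n" "tableaux n" "\<rho> n"
  proof
    show "x = 0" if "\<And>\<Lambda> i j. \<Lambda> \<in> shapes n \<Longrightarrow> i \<in> tableaux n \<Lambda> \<Longrightarrow> j \<in> tableaux n \<Lambda> \<Longrightarrow>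
        \<rho> n \<Lambda> x i j = 0" for x
      using semisimple_irreps_faithful[OF bspec[OF params(4) n, unfolded UNIV] rep irreps(2)[rule_format] that] .
  qed (rule rep)
  \<comment> \<open>Inserting the content of \<open>U\<close> makes its membership immediate for
    every \<open>j\<close>, including indices outside the tableau. Finiteness of the remaining
    values rests on \<open>finite_shapes\<close> and on the finite index sets required by
    \<open>matrix_rep\<close>.\<close>
  define S where "S j = insert (content q \<nu> U j)
    ((\<lambda>W. content q \<nu> W j) ` (\<Union>\<Lambda>\<in>shapes n. tableaux n \<Lambda>))" for j
  have finite_S: "finite (S j)" for j
    using rep finite_shapes by (auto simp: S_def matrix_rep_def)
  then have "\<forall>j. \<exists>xs. set xs = S j" using finite_list by blast
  then obtain xs where xs: "\<And>j. set (xs j) = S j" by metis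
  define p where "p j a = lagrange (xs j) a (jucys_murphy T j)" for j a
  have diag_jm: "diag (jucys_murphy T j) (\<lambda>W. content q \<nu> W j)" if "1 \<le> j" "j \<le> n" for j
    using irreps(3) that by (simp add: diag_def)
  have in_S: "content q \<nu> W j \<in> S j" if "\<Lambda> \<in> shapes n" "W \<in> tableaux n \<Lambda>" for \<Lambda> W j
    using that by (auto simp: S_def)
  have diag_p: "diag (p j a) (\<lambda>W. lagrange (xs j) a (content q \<nu> W j))" if "1 \<le> j" "j \<le> n" for j a
    unfolding p_def by (rule diag_lagrange[OF diag_jm[OF that]])
  have lagrange: "lagrange (xs j) a (content q \<nu> W j) = of_bool (content q \<nu> W j = a)"
    if "\<Lambda> \<in> shapes n" "W \<in> tableaux n \<Lambda>" for \<Lambda> W j a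
    using in_S[OF that] by (simp add: lagrange_complex xs)
  interpret jucys_murphy_spectrum n q \<nu> T "content q \<nu> U" S p
  proof
    show "finite (S j)" "content q \<nu> U j \<in> S j" for j
      by (fact finite_S) (simp add: S_def)
    show "content q \<nu> U j \<noteq> 0" for j by (rule content_nonzero[OF params(1,2)])
    show "c_param q \<nu> * (content q \<nu> U j)\<^sup>2 \<noteq> 1" if "1 \<le> j" "j \<le> n" for j
      using generic assms(6,7) that by simp
    show "jucys_murphy T i * jucys_murphy T j = jucys_murphy T j * jucys_murphy T i"
      if "1 \<le> i" "i \<le> n" "1 \<le> j" "j \<le> n" for i j
      by (rule diag_unique[OF diag_mult[OF diag_jm diag_jm] diag_mult[OF diag_jm diag_jm]])
        (use that in \<open>simp_all add: mult.commute\<close>)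
    show "(\<Sum>a\<in>S j. p j a) = 1" if "1 \<le> j" "j \<le> n" for j
    proof (rule diag_unique[OF diag_sum diag_one])
      show "finite (S j)" by (rule finite_S)
      show "diag (p j a) (\<lambda>W. lagrange (xs j) a (content q \<nu> W j))" for a
        by (rule diag_p[OF that])
      show "(\<Sum>a\<in>S j. lagrange (xs j) a (content q \<nu> W j)) = 1"
        if "\<Lambda> \<in> shapes n" "W \<in> tableaux n \<Lambda>" for \<Lambda> W
      proof -
        have "(\<Sum>a\<in>S j. lagrange (xs j) a (content q \<nu> W j)) =
            (\<Sum>a\<in>S j. if a = content q \<nu> W j then 1 else 0)"
          by (rule sum.cong) (simp_all add: lagrange[OF that])
        then show ?thesis using finite_S in_S[OF that] by simp
      qed
    qed
    show "jucys_murphy T j * p j a = a *\<^sub>C p j a" if "1 \<le> j" "j \<le> n" "a \<in> S j" for j a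
      by (rule diag_unique[OF diag_mult[OF diag_jm diag_p] diag_scaleC[OF diag_p]])
        (use that lagrange in auto)
    show "z * p j a = p j a * z" if "z * jucys_murphy T j = jucys_murphy T j * z" for z j a
      unfolding p_def by (rule lagrange_commute[OF that])
  qed
  have "Psi n q \<nu> T U = stage 0"
  proof
    fix u
    have "specialize 0 u = u" by (auto simp: specialize_def)
    then show "Psi n q \<nu> T U u = stage 0 u"
      by (simp add: Psi_def stage_def prefactor_def partial_idem_0 mult_ac del: upt_Suc)
  qed
  \<comment> \<open>Both elements are diagonal. The eigenvalue of \<open>partial_idem n\<close> at
    \<open>W\<close> is a product of indicators that \<open>W\<close> and \<open>U\<close> agree in
    the j-th content, and tableaux are separated by their contents, so it is the indicator of
    \<open>W = U\<close>, as for \<open>E\<close>.\<close>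
  moreover have "partial_idem n = E"
  proof (rule diag_unique)
    show "diag (partial_idem n)
        (\<lambda>W. prod_list (map (\<lambda>j. lagrange (xs j) (content q \<nu> U j) (content q \<nu> W j)) [1..<Suc n]))"
      unfolding partial_idem_def by (rule diag_prod_list, rule diag_p) auto
    show "diag E (\<lambda>W. of_bool (W = U))"
      unfolding diag_def
    proof (intro ballI)
      fix \<Lambda> V W assume *: "\<Lambda> \<in> shapes n" "V \<in> tableaux n \<Lambda>" "W \<in> tableaux n \<Lambda>"
      show "\<rho> n \<Lambda> E V W = of_bool (W = U) * of_bool (V = W)"
      proof (cases "\<Lambda> = last U")
        case True
        then show ?thesis using assms(8) * by (auto simp: is_tableau_idempotent_def)
      next
        case False
        then have "W \<noteq> U" using * by (auto simp: tableaux_def)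
        then show ?thesis using False assms(8) * by (simp add: is_tableau_idempotent_def)
      qed
    qed
    fix \<Lambda> W assume W: "\<Lambda> \<in> shapes n" "W \<in> tableaux n \<Lambda>"
    have "prod_list (map (\<lambda>j. of_bool (content q \<nu> W j = content q \<nu> U j)) js) =
        (of_bool (\<forall>j\<in>set js. content q \<nu> W j = content q \<nu> U j) :: complex)" for js
      by (induction js) auto
    moreover have "(\<forall>j\<in>set [1..<Suc n]. content q \<nu> W j = content q \<nu> U j) \<longleftrightarrow> W = U"
    proof
      assume "\<forall>j\<in>set [1..<Suc n]. content q \<nu> W j = content q \<nu> U j"
      then have "\<forall>j\<in>{1..n}. content q \<nu> W j = content q \<nu> U j"
        by (simp only: set_upt atLeastLessThanSuc_atLeastAtMost)
      then show "W = U" using unique W(2) by (simp add: tableaux_def)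
    qed simp
    ultimately show "prod_list (map (\<lambda>j. lagrange (xs j) (content q \<nu> U j) (content q \<nu> W j))
        [1..<Suc n]) = of_bool (W = U)"
      by (simp only: lagrange[OF W])
  qed
  ultimately show ?thesis using consecutive_evaluation_stage by simp
qed

end
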